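(* Let $\mathfrak{M}$, $A$, $B$, $\sigma$, $\pi$, $R$, $i$, $p$, $m_R,u_R,\Delta_R,\varepsilon_R,\xi,\vartriangleright,\vartriangleleft$ be as in the context (a bialgebra $A$ in an abelian and coabelian braided monoidal category with a right weak projection $\pi$ onto a sub-bialgebra $B$ with antipode, and the associated data). Assume moreover that $A$ is cocommutative, i.e. $c_{A,A}\Delta_A=\Delta_A$, and that $\xi$ is trivial, i.e. $\xi=u_B m_{\mathbf 1}(\varepsilon_R\otimes\varepsilon_R)$. a) The action $\vartriangleleft:B\otimes R\to B$ is trivial, i.e. $\vartriangleleft=r_B(B\otimes\varepsilon_R)$, if and only if $\pi$ is left $B$-linear, i.e. $\pi m_A(\sigma\otimes A)=m_B(B\otimes\pi)$. b) If $\vartriangleleft$ is trivial then the left action $\vartriangleright:B\otimes R\to R$ is the adjoint action, i.e. $i\vartriangleright=\mathrm{ad}$, where $$\mathrm{ad}:=m_A(m_A\otimes A)(\sigma\otimes i\otimes\sigma S_B)(B\otimes c_{B,R})(\Delta_B\otimes R):B\otimes R\to A.$$ c) If $\vartriangleleft$ is trivial then $A\simeq R\#B$ as bialgebras, where $B$ acts on $R$ by the left adjoint action (i.e. by $\vartriangleright$, which satisfies $i\vartriangleright=\mathrm{ad}$).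
   Context: Conventions: associativity constraints are suppressed; an object used as a morphism denotes its identity; $l_X:\mathbf{1}\otimes X\to X$ and $r_X:X\otimes\mathbf{1}\to X$ are the unit constraints; $m_{\mathbf 1}:\mathbf 1\otimes\mathbf 1\to\mathbf 1$ is the canonical isomorphism and $\Delta_{\mathbf 1}$ its inverse. $(\mathfrak{M},\otimes,\mathbf{1},c)$ is an abelian and coabelian braided monoidal category: $\mathfrak{M}$ is an abelian category and for every $X$ the functors $X\otimes(-)$ and $(-)\otimes X$ are additive, right exact (abelian) and left exact (coabelian). The braiding is a natural isomorphism $c_{X,Y}:X\otimes Y\to Y\otimes X$ with $c_{X\otimes Y,Z}=(c_{X,Z}\otimes Y)(X\otimes c_{Y,Z})$ and $c_{X,Y\otimes Z}=(Y\otimes c_{X,Z})(c_{X,Y}\otimes Z)$. A bialgebra $(B,m,u,\Delta,\varepsilon)$ in $\mathfrak{M}$ is an algebra and a coalgebra with $\Delta m=(m\otimes m)(B\otimes c_{B,B}\otimes B)(\Delta\otimes\Delta)$, $\varepsilon m=m_{\mathbf 1}(\varepsilon\otimes\varepsilon)$, $\Delta u=(u\otimes u)\Delta_{\mathbf 1}$, $\varepsilon u=\mathrm{Id}_{\mathbf 1}$. An antipode is $S:B\to B$ with $m(S\otimes B)\Delta=u\varepsilon=m(B\otimes S)\Delta$. Setting: $(A,m_A,u_A,\Delta_A,\varepsilon_A)$ is a bialgebra in $\mathfrak{M}$; $(B,m_B,u_B,\Delta_B,\varepsilon_B)$ is a sub-bialgebra of $A$ with an antipode $S_B$; $\sigma:B\to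 A$ is the canonical inclusion (a bialgebra morphism and a monomorphism); $\pi:A\to B$ is a right weak projection onto $B$, i.e. a coalgebra homomorphism with $\pi m_A(A\otimes\sigma)=m_B(\pi\otimes B)$ (right $B$-linearity) and $\pi\sigma=\mathrm{Id}_B$. Put $\Phi:=\sigma S_B\pi$ and $\Pi_2:=m_A(A\otimes\Phi)\Delta_A$. $(R,i)$, $i:R\to A$, is the equalizer of $(A\otimes\pi)\Delta_A$ and $(A\otimes u_B)r_A^{-1}$ from $A$ to $A\otimes B$; $p:A\to R$ is the unique morphism such that $ip=\Pi_2$ and $pi=\mathrm{Id}_R$ (it exists). Data: $m_R:=p\,m_A(i\otimes i)$, $u_R:=p\,u_A$, $\Delta_R:=(p\otimes p)\Delta_A i$, $\varepsilon_R:=\varepsilon_A i$, $\xi:=\pi m_A(i\otimes i):R\otimes R\to B$, $\vartriangleright:=p\,m_A(\sigma\otimes i):B\otimes R\to R$, $\vartriangleleft:=\pi m_A(\sigma\otimes i):B\otimes R\to B$. (When $A$ is cocommutative and $\xi$ is trivial, $R$ with $(m_R,u_R,\Delta_R,\varepsilon_R)$ is a bialgebra, $\vartriangleright$ is a left action of $B$ on $R$ and $\vartriangleleft$ a right action of $R$ on $B$.) The bosonization $R\#B$ is $R\otimes B$ with the smash product algebra and tensor product coalgebra structures: $m_{R\#B}=(m_R\otimes m_B)(R\otimes\vartriangleright\otimes B\otimes B)(R\otimes B\otimes c_{B,R}\otimes B)(R\otimes\Delta_B\otimes R\otimes B)$, $u_{R\#B}=(u_R\otimes u_B)\Delta_{\mathbf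 1}$, $\Delta_{R\#B}=(R\otimes c_{R,B}\otimes B)(\Delta_R\otimes\Delta_B)$, $\varepsilon_{R\#B}=m_{\mathbf 1}(\varepsilon_R\otimes\varepsilon_B)$. *)

theory Defs
  imports Main
begin

section \<open>Categories with additive, monoidal and braiding data\<close>

text \<open>
  Every element of the type \<open>'o\<close> is an object, and the morphisms from \<open>X\<close> to \<open>Y\<close> are the elements
  of the set \<open>Hom X Y\<close>. Distinct hom-sets are not required to be disjoint. Values of the operations
  outside of the relevant hom-sets carry no meaning.
\<close>

record ('o, 'm) catdata =
  Homs :: "'o \<Rightarrow> 'o \<Rightarrow> 'm set"  ("Hom\<index>")
  Comp :: "'m \<Rightarrow> 'm \<Rightarrow> 'm"  (infixl "\<cdot>\<index>" 55)
  Ident :: "'o \<Rightarrow> 'm"  ("\<langle>_\<rangle>\<index>")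
  Plus :: "'m \<Rightarrow> 'm \<Rightarrow> 'm"  (infixl "\<oplus>\<index>" 54)
  Zero :: "'o \<Rightarrow> 'o \<Rightarrow> 'm"  ("zero\<index>")
  TensorObj :: "'o \<Rightarrow> 'o \<Rightarrow> 'o"  (infixr "\<odot>\<index>" 70)
  Tensor :: "'m \<Rightarrow> 'm \<Rightarrow> 'm"  (infixr "\<otimes>\<index>" 60)
  UnitObj :: "'o"  ("\<one>\<index>")
  Assoc :: "'o \<Rightarrow> 'o \<Rightarrow> 'o \<Rightarrow> 'm"  ("assoc\<index>")
  LUnit :: "'o \<Rightarrow> 'm"  ("lunit\<index>")
  RUnit :: "'o \<Rightarrow> 'm"  ("runit\<index>")
  Braid :: "'o \<Rightarrow> 'o \<Rightarrow> 'm"  ("braid\<index>")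

subsection \<open>Categories\<close>

locale category =
  fixes M :: "('o, 'm) catdata" (structure)
  assumes ident_in: "\<langle>X\<rangle> \<in> Hom X X"
    and comp_in: "\<lbrakk>f \<in> Hom X Y; g \<in> Hom Y Z\<rbrakk> \<Longrightarrow> g \<cdot> f \<in> Hom X Z"
    and comp_ident: "f \<in> Hom X Y \<Longrightarrow> f \<cdot> \<langle>X\<rangle> = f"
    and ident_comp: "f \<in> Hom X Y \<Longrightarrow> \<langle>Y\<rangle> \<cdot> f = f"
    and comp_assoc: "\<lbrakk>f \<in> Hom X Y; g \<in> Hom Y Z; h \<in> Hom Z W\<rbrakk> \<Longrightarrow> h \<cdot> (g \<cdot> f) = h \<cdot> g \<cdot> f"

definition inverse_pair :: "('o, 'm) catdata \<Rightarrow> 'o \<Rightarrow> 'o \<Rightarrow> 'm \<Rightarrow> 'm \<Rightarrow> bool" where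
  "inverse_pair M X Y f g \<longleftrightarrow> g \<in> Hom\<^bsub>M\<^esub> Y X \<and> g \<cdot>\<^bsub>M\<^esub> f = \<langle>X\<rangle>\<^bsub>M\<^esub> \<and> f \<cdot>\<^bsub>M\<^esub> g = \<langle>Y\<rangle>\<^bsub>M\<^esub>"

definition is_iso :: "('o, 'm) catdata \<Rightarrow> 'o \<Rightarrow> 'o \<Rightarrow> 'm \<Rightarrow> bool" where
  "is_iso M X Y f \<longleftrightarrow> f \<in> Hom\<^bsub>M\<^esub> X Y \<and> (\<exists>g. inverse_pair M X Y f g)"

definition inverse :: "('o, 'm) catdata \<Rightarrow> 'o \<Rightarrow> 'o \<Rightarrow> 'm \<Rightarrow> 'm" where
  "inverse M X Y f = (THE g. inverse_pair M X Y f g)"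

definition is_mono :: "('o, 'm) catdata \<Rightarrow> 'o \<Rightarrow> 'o \<Rightarrow> 'm \<Rightarrow> bool" where
  "is_mono M X Y f \<longleftrightarrow> f \<in> Hom\<^bsub>M\<^esub> X Y \<and>
     (\<forall>T. \<forall>s \<in> Hom\<^bsub>M\<^esub> T X. \<forall>t \<in> Hom\<^bsub>M\<^esub> T X. f \<cdot>\<^bsub>M\<^esub> s = f \<cdot>\<^bsub>M\<^esub> t \<longrightarrow> s = t)"

definition is_epi :: "('o, 'm) catdata \<Rightarrow> 'o \<Rightarrow> 'o \<Rightarrow> 'm \<Rightarrow> bool" where
  "is_epi M X Y f \<longleftrightarrow> f \<in> Hom\<^bsub>M\<^esub> X Y \<and>
     (\<forall>T. \<forall>s \<in> Hom\<^bsub>M\<^esub> Y T. \<forall>t \<in> Hom\<^bsub>M\<^esub> Y T. s \<cdot>\<^bsub>M\<^esub> f = t \<cdot>\<^bsub>M\<^esub> f \<longrightarrow> s = t)"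

definition is_equalizer ::
    "('o, 'm) catdata \<Rightarrow> 'o \<Rightarrow> 'o \<Rightarrow> 'm \<Rightarrow> 'm \<Rightarrow> 'o \<Rightarrow> 'm \<Rightarrow> bool" where
  "is_equalizer M X Y f g E e \<longleftrightarrow>
     f \<in> Hom\<^bsub>M\<^esub> X Y \<and> g \<in> Hom\<^bsub>M\<^esub> X Y \<and> e \<in> Hom\<^bsub>M\<^esub> E X \<and> f \<cdot>\<^bsub>M\<^esub> e = g \<cdot>\<^bsub>M\<^esub> e \<and>
     (\<forall>T. \<forall>t \<in> Hom\<^bsub>M\<^esub> T X. f \<cdot>\<^bsub>M\<^esub> t = g \<cdot>\<^bsub>M\<^esub> t \<longrightarrow> (\<exists>!s. s \<in> Hom\<^bsub>M\<^esub> T E \<and> e \<cdot>\<^bsub>M\<^esub> s = t))"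

subsection \<open>Abelian categories\<close>

locale preadditive_category = category +
  assumes zero_in: "zero X Y \<in> Hom X Y"
    and plus_in: "\<lbrakk>f \<in> Hom X Y; g \<in> Hom X Y\<rbrakk> \<Longrightarrow> f \<oplus> g \<in> Hom X Y"
    and plus_assoc: "\<lbrakk>f \<in> Hom X Y; g \<in> Hom X Y; h \<in> Hom X Y\<rbrakk> \<Longrightarrow> (f \<oplus> g) \<oplus> h = f \<oplus> (g \<oplus> h)"
    and plus_commute: "\<lbrakk>f \<in> Hom X Y; g \<in> Hom X Y\<rbrakk> \<Longrightarrow> f \<oplus> g = g \<oplus> f"
    and zero_plus: "f \<in> Hom X Y \<Longrightarrow> zero X Y \<oplus> f = f"
    and negative: "f \<in> Hom X Y \<Longrightarrow> \<exists>g \<in> Hom X Y. f \<oplus> g = zero X Y"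
    and comp_plus: "\<lbrakk>f \<in> Hom X Y; g \<in> Hom X Y; h \<in> Hom Y Z\<rbrakk> \<Longrightarrow> h \<cdot> (f \<oplus> g) = (h \<cdot> f) \<oplus> (h \<cdot> g)"
    and plus_comp: "\<lbrakk>f \<in> Hom Y Z; g \<in> Hom Y Z; h \<in> Hom X Y\<rbrakk> \<Longrightarrow> (f \<oplus> g) \<cdot> h = (f \<cdot> h) \<oplus> (g \<cdot> h)"

definition is_kernel :: "('o, 'm) catdata \<Rightarrow> 'o \<Rightarrow> 'o \<Rightarrow> 'm \<Rightarrow> 'o \<Rightarrow> 'm \<Rightarrow> bool" where
  "is_kernel M X Y f K k \<longleftrightarrow> is_equalizer M X Y f (zero\<^bsub>M\<^esub> X Y) K k"

definition is_cokernel :: "('o, 'm) catdata \<Rightarrow> 'o \<Rightarrow> 'o \<Rightarrow> 'm \<Rightarrow> 'o \<Rightarrow> 'm \<Rightarrow> bool" where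
  "is_cokernel M X Y f Q q \<longleftrightarrow>
     f \<in> Hom\<^bsub>M\<^esub> X Y \<and> q \<in> Hom\<^bsub>M\<^esub> Y Q \<and> q \<cdot>\<^bsub>M\<^esub> f = zero\<^bsub>M\<^esub> X Q \<and>
     (\<forall>T. \<forall>t \<in> Hom\<^bsub>M\<^esub> Y T. t \<cdot>\<^bsub>M\<^esub> f = zero\<^bsub>M\<^esub> X T \<longrightarrow> (\<exists>!s. s \<in> Hom\<^bsub>M\<^esub> Q T \<and> s \<cdot>\<^bsub>M\<^esub> q = t))"

definition is_zero_object :: "('o, 'm) catdata \<Rightarrow> 'o \<Rightarrow> bool" where
  "is_zero_object M Z \<longleftrightarrow> (\<forall>X. (\<exists>!f. f \<in> Hom\<^bsub>M\<^esub> X Z) \<and> (\<exists>!f. f \<in> Hom\<^bsub>M\<^esub> Z X))"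

definition is_biproduct ::
    "('o, 'm) catdata \<Rightarrow> 'o \<Rightarrow> 'o \<Rightarrow> 'o \<Rightarrow> 'm \<Rightarrow> 'm \<Rightarrow> 'm \<Rightarrow> 'm \<Rightarrow> bool" where
  "is_biproduct M X Y P j\<^sub>1 j\<^sub>2 p\<^sub>1 p\<^sub>2 \<longleftrightarrow>
     j\<^sub>1 \<in> Hom\<^bsub>M\<^esub> X P \<and> j\<^sub>2 \<in> Hom\<^bsub>M\<^esub> Y P \<and> p\<^sub>1 \<in> Hom\<^bsub>M\<^esub> P X \<and> p\<^sub>2 \<in> Hom\<^bsub>M\<^esub> P Y \<and>
     p\<^sub>1 \<cdot>\<^bsub>M\<^esub> j\<^sub>1 = \<langle>X\<rangle>\<^bsub>M\<^esub> \<and> p\<^sub>2 \<cdot>\<^bsub>M\<^esub> j\<^sub>2 = \<langle>Y\<rangle>\<^bsub>M\<^esub> \<and>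
     p\<^sub>1 \<cdot>\<^bsub>M\<^esub> j\<^sub>2 = zero\<^bsub>M\<^esub> Y X \<and> p\<^sub>2 \<cdot>\<^bsub>M\<^esub> j\<^sub>1 = zero\<^bsub>M\<^esub> X Y \<and>
     (j\<^sub>1 \<cdot>\<^bsub>M\<^esub> p\<^sub>1) \<oplus>\<^bsub>M\<^esub> (j\<^sub>2 \<cdot>\<^bsub>M\<^esub> p\<^sub>2) = \<langle>P\<rangle>\<^bsub>M\<^esub>"

locale abelian_category = preadditive_category +
  assumes zero_object: "\<exists>Z. is_zero_object M Z"
    and biproducts: "\<exists>P j\<^sub>1 j\<^sub>2 p\<^sub>1 p\<^sub>2. is_biproduct M X Y P j\<^sub>1 j\<^sub>2 p\<^sub>1 p\<^sub>2"
    and kernels: "f \<in> Hom X Y \<Longrightarrow> \<exists>K k. is_kernel M X Y f K k"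
    and cokernels: "f \<in> Hom X Y \<Longrightarrow> \<exists>Q q. is_cokernel M X Y f Q q"
    and mono_is_kernel: "is_mono M X Y f \<Longrightarrow> \<exists>Z g. is_kernel M Y Z g X f"
    and epi_is_cokernel: "is_epi M X Y f \<Longrightarrow> \<exists>Z g. is_cokernel M Z X g Y f"

text \<open>
  The following three predicates concern an endofunctor with object map \<open>F\<close> and morphism map \<open>G\<close>.
  An additive functor is left exact if it preserves exactness of sequences \<open>0 \<rightarrow> K \<rightarrow> X \<rightarrow> Y\<close>, that is,
  if it preserves kernels; dually for right exactness and cokernels.
\<close>

definition additive_functor :: "('o, 'm) catdata \<Rightarrow> ('o \<Rightarrow> 'o) \<Rightarrow> ('m \<Rightarrow> 'm) \<Rightarrow> bool" where
  "additive_functor M F G \<longleftrightarrow>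
     (\<forall>X Y. \<forall>f \<in> Hom\<^bsub>M\<^esub> X Y. \<forall>g \<in> Hom\<^bsub>M\<^esub> X Y. G (f \<oplus>\<^bsub>M\<^esub> g) = G f \<oplus>\<^bsub>M\<^esub> G g)"

definition left_exact :: "('o, 'm) catdata \<Rightarrow> ('o \<Rightarrow> 'o) \<Rightarrow> ('m \<Rightarrow> 'm) \<Rightarrow> bool" where
  "left_exact M F G \<longleftrightarrow>
     (\<forall>X Y f K k. is_kernel M X Y f K k \<longrightarrow> is_kernel M (F X) (F Y) (G f) (F K) (G k))"

definition right_exact :: "('o, 'm) catdata \<Rightarrow> ('o \<Rightarrow> 'o) \<Rightarrow> ('m \<Rightarrow> 'm) \<Rightarrow> bool" where
  "right_exact M F G \<longleftrightarrow>
     (\<forall>X Y f Q q. is_cokernel M X Y f Q q \<longrightarrow> is_cokernel M (F X) (F Y) (G f) (F Q) (G q))"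

subsection \<open>Monoidal categories\<close>

locale monoidal_category = category +
  assumes tensor_in: "\<lbrakk>f \<in> Hom X Y; f' \<in> Hom X' Y'\<rbrakk> \<Longrightarrow> f \<otimes> f' \<in> Hom (X \<odot> X') (Y \<odot> Y')"
    and tensor_ident: "\<langle>X\<rangle> \<otimes> \<langle>Y\<rangle> = \<langle>X \<odot> Y\<rangle>"
    and tensor_comp: "\<lbrakk>f \<in> Hom X Y; g \<in> Hom Y Z; f' \<in> Hom X' Y'; g' \<in> Hom Y' Z'\<rbrakk>
      \<Longrightarrow> (g \<cdot> f) \<otimes> (g' \<cdot> f') = (g \<otimes> g') \<cdot> (f \<otimes> f')"
    and assoc_iso: "is_iso M ((X \<odot> Y) \<odot> Z) (X \<odot> (Y \<odot> Z)) (assoc X Y Z)"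
    and assoc_natural: "\<lbrakk>f \<in> Hom X X'; g \<in> Hom Y Y'; h \<in> Hom Z Z'\<rbrakk>
      \<Longrightarrow> assoc X' Y' Z' \<cdot> ((f \<otimes> g) \<otimes> h) = (f \<otimes> (g \<otimes> h)) \<cdot> assoc X Y Z"
    and lunit_iso: "is_iso M (\<one> \<odot> X) X (lunit X)"
    and lunit_natural: "f \<in> Hom X Y \<Longrightarrow> lunit Y \<cdot> (\<langle>\<one>\<rangle> \<otimes> f) = f \<cdot> lunit X"
    and runit_iso: "is_iso M (X \<odot> \<one>) X (runit X)"
    and runit_natural: "f \<in> Hom X Y \<Longrightarrow> runit Y \<cdot> (f \<otimes> \<langle>\<one>\<rangle>) = f \<cdot> runit X"
    and pentagon: "(\<langle>W\<rangle> \<otimes> assoc X Y Z) \<cdot> assoc W (X \<odot> Y) Z \<cdot> (assoc W X Y \<otimes> \<langle>Z\<rangle>)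
      = assoc W X (Y \<odot> Z) \<cdot> assoc (W \<odot> X) Y Z"
    and triangle: "(\<langle>X\<rangle> \<otimes> lunit Y) \<cdot> assoc X \<one> Y = runit X \<otimes> \<langle>Y\<rangle>"

definition assoc_inv :: "('o, 'm) catdata \<Rightarrow> 'o \<Rightarrow> 'o \<Rightarrow> 'o \<Rightarrow> 'm"  ("assoc'_inv\<index>") where
  "assoc_inv\<^bsub>M\<^esub> X Y Z =
     inverse M ((X \<odot>\<^bsub>M\<^esub> Y) \<odot>\<^bsub>M\<^esub> Z) (X \<odot>\<^bsub>M\<^esub> (Y \<odot>\<^bsub>M\<^esub> Z)) (assoc\<^bsub>M\<^esub> X Y Z)"

definition runit_inv :: "('o, 'm) catdata \<Rightarrow> 'o \<Rightarrow> 'm"  ("runit'_inv\<index>") where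
  "runit_inv\<^bsub>M\<^esub> X = inverse M (X \<odot>\<^bsub>M\<^esub> \<one>\<^bsub>M\<^esub>) X (runit\<^bsub>M\<^esub> X)"

text \<open>
  The canonical isomorphism \<open>\<one> \<odot> \<one> \<rightarrow> \<one>\<close> is \<open>lunit \<one>\<close>, which equals \<open>runit \<one>\<close> in every monoidal
  category.
\<close>

definition mult_one :: "('o, 'm) catdata \<Rightarrow> 'm"  ("mult'_one\<index>") where
  "mult_one\<^bsub>M\<^esub> = lunit\<^bsub>M\<^esub> \<one>\<^bsub>M\<^esub>"

definition comult_one :: "('o, 'm) catdata \<Rightarrow> 'm"  ("comult'_one\<index>") where
  "comult_one\<^bsub>M\<^esub> = inverse M (\<one>\<^bsub>M\<^esub> \<odot>\<^bsub>M\<^esub> \<one>\<^bsub>M\<^esub>) \<one>\<^bsub>M\<^esub> mult_one\<^bsub>M\<^esub>"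

text \<open>
  The associativity isomorphisms \<open>(W \<odot> X) \<odot> (Y \<odot> Z) \<rightarrow> W \<odot> ((X \<odot> Y) \<odot> Z)\<close> and back. With them a
  morphism \<open>W \<otimes> f \<otimes> Z\<close> acts on the two middle factors of \<open>(W \<odot> X) \<odot> (Y \<odot> Z)\<close>.
\<close>

definition to_mid :: "('o, 'm) catdata \<Rightarrow> 'o \<Rightarrow> 'o \<Rightarrow> 'o \<Rightarrow> 'o \<Rightarrow> 'm"  ("to'_mid\<index>") where
  "to_mid\<^bsub>M\<^esub> W X Y Z = (\<langle>W\<rangle>\<^bsub>M\<^esub> \<otimes>\<^bsub>M\<^esub> assoc_inv\<^bsub>M\<^esub> X Y Z) \<cdot>\<^bsub>M\<^esub> assoc\<^bsub>M\<^esub> W X (Y \<odot>\<^bsub>M\<^esub> Z)"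

definition from_mid :: "('o, 'm) catdata \<Rightarrow> 'o \<Rightarrow> 'o \<Rightarrow> 'o \<Rightarrow> 'o \<Rightarrow> 'm"  ("from'_mid\<index>") where
  "from_mid\<^bsub>M\<^esub> W X Y Z = assoc_inv\<^bsub>M\<^esub> W X (Y \<odot>\<^bsub>M\<^esub> Z) \<cdot>\<^bsub>M\<^esub> (\<langle>W\<rangle>\<^bsub>M\<^esub> \<otimes>\<^bsub>M\<^esub> assoc\<^bsub>M\<^esub> X Y Z)"

locale braided_monoidal_category = monoidal_category +
  assumes braid_iso: "is_iso M (X \<odot> Y) (Y \<odot> X) (braid X Y)"
    and braid_natural: "\<lbrakk>f \<in> Hom X X'; g \<in> Hom Y Y'\<rbrakk>
      \<Longrightarrow> braid X' Y' \<cdot> (f \<otimes> g) = (g \<otimes> f) \<cdot> braid X Y"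
    and braid_tensor_left: "braid (X \<odot> Y) Z =
      assoc Z X Y \<cdot> (braid X Z \<otimes> \<langle>Y\<rangle>) \<cdot> assoc_inv X Z Y \<cdot> (\<langle>X\<rangle> \<otimes> braid Y Z) \<cdot> assoc X Y Z"
    and braid_tensor_right: "braid X (Y \<odot> Z) =
      assoc_inv Y Z X \<cdot> (\<langle>Y\<rangle> \<otimes> braid X Z) \<cdot> assoc Y X Z \<cdot> (braid X Y \<otimes> \<langle>Z\<rangle>) \<cdot> assoc_inv X Y Z"

locale abelian_coabelian_braided_monoidal_category =
  abelian_category + braided_monoidal_category +
  assumes tensor_left_additive: "additive_functor M (\<lambda>Y. X \<odot> Y) (\<lambda>f. \<langle>X\<rangle> \<otimes> f)"
    and tensor_right_additive: "additive_functor M (\<lambda>Y. Y \<odot> X) (\<lambda>f. f \<otimes> \<langle>X\<rangle>)"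
    and tensor_left_right_exact: "right_exact M (\<lambda>Y. X \<odot> Y) (\<lambda>f. \<langle>X\<rangle> \<otimes> f)"
    and tensor_right_right_exact: "right_exact M (\<lambda>Y. Y \<odot> X) (\<lambda>f. f \<otimes> \<langle>X\<rangle>)"
    and tensor_left_left_exact: "left_exact M (\<lambda>Y. X \<odot> Y) (\<lambda>f. \<langle>X\<rangle> \<otimes> f)"
    and tensor_right_left_exact: "left_exact M (\<lambda>Y. Y \<odot> X) (\<lambda>f. f \<otimes> \<langle>X\<rangle>)"

section \<open>Bialgebras in a braided monoidal category\<close>

record ('o, 'm) bialg =
  obj :: 'o
  mult :: 'm
  unit :: 'm
  comult :: 'm
  counit :: 'm

locale is_algebra =
  fixes M :: "('o, 'm) catdata" (structure) and B :: "('o, 'm) bialg"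
  assumes mult_in: "mult B \<in> Hom (obj B \<odot> obj B) (obj B)"
    and unit_in: "unit B \<in> Hom \<one> (obj B)"
    and mult_assoc: "mult B \<cdot> (mult B \<otimes> \<langle>obj B\<rangle>)
      = mult B \<cdot> (\<langle>obj B\<rangle> \<otimes> mult B) \<cdot> assoc (obj B) (obj B) (obj B)"
    and unit_left: "mult B \<cdot> (unit B \<otimes> \<langle>obj B\<rangle>) = lunit (obj B)"
    and unit_right: "mult B \<cdot> (\<langle>obj B\<rangle> \<otimes> unit B) = runit (obj B)"

locale is_coalgebra =
  fixes M :: "('o, 'm) catdata" (structure) and B :: "('o, 'm) bialg"
  assumes comult_in: "comult B \<in> Hom (obj B) (obj B \<odot> obj B)"
    and counit_in: "counit B \<in> Hom (obj B) \<one>"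
    and comult_coassoc: "assoc (obj B) (obj B) (obj B) \<cdot> (comult B \<otimes> \<langle>obj B\<rangle>) \<cdot> comult B
      = (\<langle>obj B\<rangle> \<otimes> comult B) \<cdot> comult B"
    and counit_left: "lunit (obj B) \<cdot> (counit B \<otimes> \<langle>obj B\<rangle>) \<cdot> comult B = \<langle>obj B\<rangle>"
    and counit_right: "runit (obj B) \<cdot> (\<langle>obj B\<rangle> \<otimes> counit B) \<cdot> comult B = \<langle>obj B\<rangle>"

locale is_bialgebra = is_algebra + is_coalgebra +
  assumes comult_mult: "comult B \<cdot> mult B =
      (mult B \<otimes> mult B)
      \<cdot> from_mid (obj B) (obj B) (obj B) (obj B)
      \<cdot> (\<langle>obj B\<rangle> \<otimes> (braid (obj B) (obj B) \<otimes> \<langle>obj B\<rangle>))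
      \<cdot> to_mid (obj B) (obj B) (obj B) (obj B)
      \<cdot> (comult B \<otimes> comult B)"
    and counit_mult: "counit B \<cdot> mult B = mult_one \<cdot> (counit B \<otimes> counit B)"
    and comult_unit: "comult B \<cdot> unit B = (unit B \<otimes> unit B) \<cdot> comult_one"
    and counit_unit: "counit B \<cdot> unit B = \<langle>\<one>\<rangle>"

definition is_cocommutative :: "('o, 'm) catdata \<Rightarrow> ('o, 'm) bialg \<Rightarrow> bool" where
  "is_cocommutative M B \<longleftrightarrow> braid\<^bsub>M\<^esub> (obj B) (obj B) \<cdot>\<^bsub>M\<^esub> comult B = comult B"

definition is_antipode :: "('o, 'm) catdata \<Rightarrow> ('o, 'm) bialg \<Rightarrow> 'm \<Rightarrow> bool" where
  "is_antipode M B S \<longleftrightarrow> S \<in> Hom\<^bsub>M\<^esub> (obj B) (obj B) \<and>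
     mult B \<cdot>\<^bsub>M\<^esub> (S \<otimes>\<^bsub>M\<^esub> \<langle>obj B\<rangle>\<^bsub>M\<^esub>) \<cdot>\<^bsub>M\<^esub> comult B = unit B \<cdot>\<^bsub>M\<^esub> counit B \<and>
     mult B \<cdot>\<^bsub>M\<^esub> (\<langle>obj B\<rangle>\<^bsub>M\<^esub> \<otimes>\<^bsub>M\<^esub> S) \<cdot>\<^bsub>M\<^esub> comult B = unit B \<cdot>\<^bsub>M\<^esub> counit B"

definition is_algebra_hom ::
    "('o, 'm) catdata \<Rightarrow> ('o, 'm) bialg \<Rightarrow> ('o, 'm) bialg \<Rightarrow> 'm \<Rightarrow> bool" where
  "is_algebra_hom M B C f \<longleftrightarrow> f \<in> Hom\<^bsub>M\<^esub> (obj B) (obj C) \<and>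
     f \<cdot>\<^bsub>M\<^esub> mult B = mult C \<cdot>\<^bsub>M\<^esub> (f \<otimes>\<^bsub>M\<^esub> f) \<and> f \<cdot>\<^bsub>M\<^esub> unit B = unit C"

definition is_coalgebra_hom ::
    "('o, 'm) catdata \<Rightarrow> ('o, 'm) bialg \<Rightarrow> ('o, 'm) bialg \<Rightarrow> 'm \<Rightarrow> bool" where
  "is_coalgebra_hom M B C f \<longleftrightarrow> f \<in> Hom\<^bsub>M\<^esub> (obj B) (obj C) \<and>
     comult C \<cdot>\<^bsub>M\<^esub> f = (f \<otimes>\<^bsub>M\<^esub> f) \<cdot>\<^bsub>M\<^esub> comult B \<and> counit C \<cdot>\<^bsub>M\<^esub> f = counit B"

definition is_bialgebra_hom ::
    "('o, 'm) catdata \<Rightarrow> ('o, 'm) bialg \<Rightarrow> ('o, 'm) bialg \<Rightarrow> 'm \<Rightarrow> bool" where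
  "is_bialgebra_hom M B C f \<longleftrightarrow> is_algebra_hom M B C f \<and> is_coalgebra_hom M B C f"

definition bialgebras_isomorphic ::
    "('o, 'm) catdata \<Rightarrow> ('o, 'm) bialg \<Rightarrow> ('o, 'm) bialg \<Rightarrow> bool" where
  "bialgebras_isomorphic M B C \<longleftrightarrow> is_bialgebra M B \<and> is_bialgebra M C \<and>
     (\<exists>f. is_iso M (obj B) (obj C) f \<and> is_bialgebra_hom M B C f)"

definition is_left_action :: "('o, 'm) catdata \<Rightarrow> ('o, 'm) bialg \<Rightarrow> 'o \<Rightarrow> 'm \<Rightarrow> bool" where
  "is_left_action M B X a \<longleftrightarrow> a \<in> Hom\<^bsub>M\<^esub> (obj B \<odot>\<^bsub>M\<^esub> X) X \<and>
     a \<cdot>\<^bsub>M\<^esub> (mult B \<otimes>\<^bsub>M\<^esub> \<langle>X\<rangle>\<^bsub>M\<^esub>) =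
       a \<cdot>\<^bsub>M\<^esub> (\<langle>obj B\<rangle>\<^bsub>M\<^esub> \<otimes>\<^bsub>M\<^esub> a) \<cdot>\<^bsub>M\<^esub> assoc\<^bsub>M\<^esub> (obj B) (obj B) X \<and>
     a \<cdot>\<^bsub>M\<^esub> (unit B \<otimes>\<^bsub>M\<^esub> \<langle>X\<rangle>\<^bsub>M\<^esub>) = lunit\<^bsub>M\<^esub> X"

text \<open>
  \<open>bosonization M R B act\<close> is \<open>R \<odot> B\<close> with the smash product algebra and the tensor product coalgebra
  structures, for a morphism \<open>act\<close> from \<open>obj B \<odot> obj R\<close> to \<open>obj R\<close>. The middle part of the
  multiplication is carried out in \<open>R \<odot> ((B \<odot> R) \<odot> B)\<close>.
\<close>

definition bosonization ::
    "('o, 'm) catdata \<Rightarrow> ('o, 'm) bialg \<Rightarrow> ('o, 'm) bialg \<Rightarrow> 'm \<Rightarrow> ('o, 'm) bialg" where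
  "bosonization M R B act = \<lparr>
     obj = obj R \<odot>\<^bsub>M\<^esub> obj B,
     mult = (mult R \<otimes>\<^bsub>M\<^esub> mult B)
       \<cdot>\<^bsub>M\<^esub> from_mid\<^bsub>M\<^esub> (obj R) (obj R) (obj B) (obj B)
       \<cdot>\<^bsub>M\<^esub> (\<langle>obj R\<rangle>\<^bsub>M\<^esub> \<otimes>\<^bsub>M\<^esub> ((act \<otimes>\<^bsub>M\<^esub> \<langle>obj B\<rangle>\<^bsub>M\<^esub>) \<otimes>\<^bsub>M\<^esub> \<langle>obj B\<rangle>\<^bsub>M\<^esub>))
       \<cdot>\<^bsub>M\<^esub> (\<langle>obj R\<rangle>\<^bsub>M\<^esub> \<otimes>\<^bsub>M\<^esub> (assoc_inv\<^bsub>M\<^esub> (obj B) (obj R) (obj B) \<otimes>\<^bsub>M\<^esub> \<langle>obj B\<rangle>\<^bsub>M\<^esub>))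
       \<cdot>\<^bsub>M\<^esub> (\<langle>obj R\<rangle>\<^bsub>M\<^esub> \<otimes>\<^bsub>M\<^esub> ((\<langle>obj B\<rangle>\<^bsub>M\<^esub> \<otimes>\<^bsub>M\<^esub> braid\<^bsub>M\<^esub> (obj B) (obj R)) \<otimes>\<^bsub>M\<^esub> \<langle>obj B\<rangle>\<^bsub>M\<^esub>))
       \<cdot>\<^bsub>M\<^esub> (\<langle>obj R\<rangle>\<^bsub>M\<^esub> \<otimes>\<^bsub>M\<^esub> (assoc\<^bsub>M\<^esub> (obj B) (obj B) (obj R) \<otimes>\<^bsub>M\<^esub> \<langle>obj B\<rangle>\<^bsub>M\<^esub>))
       \<cdot>\<^bsub>M\<^esub> (\<langle>obj R\<rangle>\<^bsub>M\<^esub> \<otimes>\<^bsub>M\<^esub> ((comult B \<otimes>\<^bsub>M\<^esub> \<langle>obj R\<rangle>\<^bsub>M\<^esub>) \<otimes>\<^bsub>M\<^esub> \<langle>obj B\<rangle>\<^bsub>M\<^esub>))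
       \<cdot>\<^bsub>M\<^esub> to_mid\<^bsub>M\<^esub> (obj R) (obj B) (obj R) (obj B),
     unit = (unit R \<otimes>\<^bsub>M\<^esub> unit B) \<cdot>\<^bsub>M\<^esub> comult_one\<^bsub>M\<^esub>,
     comult = from_mid\<^bsub>M\<^esub> (obj R) (obj B) (obj R) (obj B)
       \<cdot>\<^bsub>M\<^esub> (\<langle>obj R\<rangle>\<^bsub>M\<^esub> \<otimes>\<^bsub>M\<^esub> (braid\<^bsub>M\<^esub> (obj R) (obj B) \<otimes>\<^bsub>M\<^esub> \<langle>obj B\<rangle>\<^bsub>M\<^esub>))
       \<cdot>\<^bsub>M\<^esub> to_mid\<^bsub>M\<^esub> (obj R) (obj R) (obj B) (obj B)
       \<cdot>\<^bsub>M\<^esub> (comult R \<otimes>\<^bsub>M\<^esub> comult B),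
     counit = mult_one\<^bsub>M\<^esub> \<cdot>\<^bsub>M\<^esub> (counit R \<otimes>\<^bsub>M\<^esub> counit B) \<rparr>"

section \<open>Weak projections\<close>

definition is_sub_bialgebra ::
    "('o, 'm) catdata \<Rightarrow> ('o, 'm) bialg \<Rightarrow> ('o, 'm) bialg \<Rightarrow> 'm \<Rightarrow> bool" where
  "is_sub_bialgebra M A B \<sigma> \<longleftrightarrow>
     is_bialgebra M B \<and> is_bialgebra_hom M B A \<sigma> \<and> is_mono M (obj B) (obj A) \<sigma>"

definition is_right_weak_projection ::
    "('o, 'm) catdata \<Rightarrow> ('o, 'm) bialg \<Rightarrow> ('o, 'm) bialg \<Rightarrow> 'm \<Rightarrow> 'm \<Rightarrow> bool" where
  "is_right_weak_projection M A B \<sigma> \<pi> \<longleftrightarrow> is_coalgebra_hom M A B \<pi> \<and>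
     \<pi> \<cdot>\<^bsub>M\<^esub> mult A \<cdot>\<^bsub>M\<^esub> (\<langle>obj A\<rangle>\<^bsub>M\<^esub> \<otimes>\<^bsub>M\<^esub> \<sigma>) = mult B \<cdot>\<^bsub>M\<^esub> (\<pi> \<otimes>\<^bsub>M\<^esub> \<langle>obj B\<rangle>\<^bsub>M\<^esub>) \<and>
     \<pi> \<cdot>\<^bsub>M\<^esub> \<sigma> = \<langle>obj B\<rangle>\<^bsub>M\<^esub>"

definition is_left_linear ::
    "('o, 'm) catdata \<Rightarrow> ('o, 'm) bialg \<Rightarrow> ('o, 'm) bialg \<Rightarrow> 'm \<Rightarrow> 'm \<Rightarrow> bool" where
  "is_left_linear M A B \<sigma> \<pi> \<longleftrightarrow>
     \<pi> \<cdot>\<^bsub>M\<^esub> mult A \<cdot>\<^bsub>M\<^esub> (\<sigma> \<otimes>\<^bsub>M\<^esub> \<langle>obj A\<rangle>\<^bsub>M\<^esub>) = mult B \<cdot>\<^bsub>M\<^esub> (\<langle>obj B\<rangle>\<^bsub>M\<^esub> \<otimes>\<^bsub>M\<^esub> \<pi>)"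

definition Phi :: "('o, 'm) catdata \<Rightarrow> 'm \<Rightarrow> 'm \<Rightarrow> 'm \<Rightarrow> 'm" where
  "Phi M \<sigma> S \<pi> = \<sigma> \<cdot>\<^bsub>M\<^esub> S \<cdot>\<^bsub>M\<^esub> \<pi>"

definition Pi2 :: "('o, 'm) catdata \<Rightarrow> ('o, 'm) bialg \<Rightarrow> 'm \<Rightarrow> 'm \<Rightarrow> 'm \<Rightarrow> 'm" where
  "Pi2 M A \<sigma> S \<pi> = mult A \<cdot>\<^bsub>M\<^esub> (\<langle>obj A\<rangle>\<^bsub>M\<^esub> \<otimes>\<^bsub>M\<^esub> Phi M \<sigma> S \<pi>) \<cdot>\<^bsub>M\<^esub> comult A"

text \<open>The object of coinvariants of \<open>\<pi>\<close>.\<close>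

definition is_coinvariants ::
    "('o, 'm) catdata \<Rightarrow> ('o, 'm) bialg \<Rightarrow> ('o, 'm) bialg \<Rightarrow> 'm \<Rightarrow> 'o \<Rightarrow> 'm \<Rightarrow> bool" where
  "is_coinvariants M A B \<pi> R i \<longleftrightarrow>
     is_equalizer M (obj A) (obj A \<odot>\<^bsub>M\<^esub> obj B)
       ((\<langle>obj A\<rangle>\<^bsub>M\<^esub> \<otimes>\<^bsub>M\<^esub> \<pi>) \<cdot>\<^bsub>M\<^esub> comult A)
       ((\<langle>obj A\<rangle>\<^bsub>M\<^esub> \<otimes>\<^bsub>M\<^esub> unit B) \<cdot>\<^bsub>M\<^esub> runit_inv\<^bsub>M\<^esub> (obj A)) R i"

definition coinvariant_data ::
    "('o, 'm) catdata \<Rightarrow> ('o, 'm) bialg \<Rightarrow> 'o \<Rightarrow> 'm \<Rightarrow> 'm \<Rightarrow> ('o, 'm) bialg" where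
  "coinvariant_data M A R i p = \<lparr>
     obj = R,
     mult = p \<cdot>\<^bsub>M\<^esub> mult A \<cdot>\<^bsub>M\<^esub> (i \<otimes>\<^bsub>M\<^esub> i),
     unit = p \<cdot>\<^bsub>M\<^esub> unit A,
     comult = (p \<otimes>\<^bsub>M\<^esub> p) \<cdot>\<^bsub>M\<^esub> comult A \<cdot>\<^bsub>M\<^esub> i,
     counit = counit A \<cdot>\<^bsub>M\<^esub> i \<rparr>"

definition cocycle :: "('o, 'm) catdata \<Rightarrow> ('o, 'm) bialg \<Rightarrow> 'm \<Rightarrow> 'm \<Rightarrow> 'm" where
  "cocycle M A \<pi> i = \<pi> \<cdot>\<^bsub>M\<^esub> mult A \<cdot>\<^bsub>M\<^esub> (i \<otimes>\<^bsub>M\<^esub> i)"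

definition cocycle_trivial ::
    "('o, 'm) catdata \<Rightarrow> ('o, 'm) bialg \<Rightarrow> ('o, 'm) bialg \<Rightarrow> 'm \<Rightarrow> bool" where
  "cocycle_trivial M R B \<xi> \<longleftrightarrow>
     \<xi> = unit B \<cdot>\<^bsub>M\<^esub> mult_one\<^bsub>M\<^esub> \<cdot>\<^bsub>M\<^esub> (counit R \<otimes>\<^bsub>M\<^esub> counit R)"

definition left_act :: "('o, 'm) catdata \<Rightarrow> ('o, 'm) bialg \<Rightarrow> 'm \<Rightarrow> 'm \<Rightarrow> 'm \<Rightarrow> 'm" where
  "left_act M A \<sigma> i p = p \<cdot>\<^bsub>M\<^esub> mult A \<cdot>\<^bsub>M\<^esub> (\<sigma> \<otimes>\<^bsub>M\<^esub> i)"

definition right_act :: "('o, 'm) catdata \<Rightarrow> ('o, 'm) bialg \<Rightarrow> 'm \<Rightarrow> 'm \<Rightarrow> 'm \<Rightarrow> 'm" where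
  "right_act M A \<sigma> \<pi> i = \<pi> \<cdot>\<^bsub>M\<^esub> mult A \<cdot>\<^bsub>M\<^esub> (\<sigma> \<otimes>\<^bsub>M\<^esub> i)"

definition right_act_trivial ::
    "('o, 'm) catdata \<Rightarrow> ('o, 'm) bialg \<Rightarrow> ('o, 'm) bialg \<Rightarrow> 'm \<Rightarrow> bool" where
  "right_act_trivial M R B a \<longleftrightarrow>
     a = runit\<^bsub>M\<^esub> (obj B) \<cdot>\<^bsub>M\<^esub> (\<langle>obj B\<rangle>\<^bsub>M\<^esub> \<otimes>\<^bsub>M\<^esub> counit R)"

definition adjoint_act ::
    "('o, 'm) catdata \<Rightarrow> ('o, 'm) bialg \<Rightarrow> ('o, 'm) bialg \<Rightarrow> 'm \<Rightarrow> 'm \<Rightarrow> 'o \<Rightarrow> 'm \<Rightarrow> 'm" where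
  "adjoint_act M A B \<sigma> S R i =
     mult A \<cdot>\<^bsub>M\<^esub> (mult A \<otimes>\<^bsub>M\<^esub> \<langle>obj A\<rangle>\<^bsub>M\<^esub>)
     \<cdot>\<^bsub>M\<^esub> ((\<sigma> \<otimes>\<^bsub>M\<^esub> i) \<otimes>\<^bsub>M\<^esub> (\<sigma> \<cdot>\<^bsub>M\<^esub> S))
     \<cdot>\<^bsub>M\<^esub> assoc_inv\<^bsub>M\<^esub> (obj B) R (obj B)
     \<cdot>\<^bsub>M\<^esub> (\<langle>obj B\<rangle>\<^bsub>M\<^esub> \<otimes>\<^bsub>M\<^esub> braid\<^bsub>M\<^esub> (obj B) R)
     \<cdot>\<^bsub>M\<^esub> assoc\<^bsub>M\<^esub> (obj B) (obj B) R
     \<cdot>\<^bsub>M\<^esub> (comult B \<otimes>\<^bsub>M\<^esub> \<langle>R\<rangle>\<^bsub>M\<^esub>)"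

end

theory Submission
  imports Defs
begin

text \<open>
  In Sweedler notation, and with \<open>\<sigma>\<close> and \<open>i\<close> suppressed, the multiplication map
  \<open>\<phi> : R \<otimes> B \<rightarrow> A\<close>, \<open>r \<otimes> b \<mapsto> r b\<close>, is invertible with inverse
  \<open>\<psi> : a \<mapsto> p(a\<^sub>1) \<otimes> \<pi>(a\<^sub>2)\<close>, and everything is read off from this decomposition.

  The main device is the right coaction \<open>(A \<otimes> \<pi>) \<Delta>\<close> of \<open>B\<close> on \<open>A\<close>. Since \<open>i p\<close> is this coaction
  followed by \<open>a \<otimes> b \<mapsto> a S(b)\<close>, to know the coaction of a product is to know its image under \<open>p\<close>.
  The coaction of a product is computed from multiplicativity of \<open>\<Delta>\<close> in three cases.

  \<^item> Coinvariance and right linearity of \<open>\<pi>\<close> give \<open>r b \<mapsto> r b\<^sub>1 \<otimes> b\<^sub>2\<close> (\<open>coaction_\<phi>\<close>), hence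
    \<open>p(r b) = r \<epsilon>(b)\<close>, and from that \<open>\<psi> \<phi> = Id\<close>. The equation \<open>\<phi> \<psi> = Id\<close> is the antipode axiom.
    As \<open>\<phi>\<close> is invertible, it also follows that \<open>p(a b) = p(a) \<epsilon>(b)\<close> and \<open>p(b a) = b \<rhd> p(a)\<close> for
    every \<open>a\<close> in \<open>A\<close>; the second equation makes \<open>\<rhd>\<close> an action.
  \<^item> If \<open>\<xi>\<close> is trivial, then \<open>r r' \<mapsto> r r' \<otimes> 1\<close> (in \<open>j_Mult\<close>), so \<open>R\<close> is closed under the
    multiplication of \<open>A\<close>.
  \<^item> If the right action of \<open>R\<close> on \<open>B\<close> is trivial, then \<open>b r \<mapsto> b\<^sub>1 r \<otimes> b\<^sub>2\<close>
    (\<open>coaction_product\<close>). This gives \<open>b \<rhd> r = b\<^sub>1 r S(b\<^sub>2)\<close>, which is assertion b), and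
    \<open>b r = \<phi>(\<psi>(b r)) = (b\<^sub>1 \<rhd> r) b\<^sub>2\<close>.

  The last equation and the closure of \<open>R\<close> say that \<open>\<phi>\<close> carries the smash product to the
  multiplication of \<open>A\<close>. Cocommutativity enters through \<open>j_Comult\<close>: the comultiplication of \<open>A\<close>
  restricts to \<open>R\<close>, which makes \<open>\<phi>\<close> comultiplicative and underlies the last two coaction formulas.
  So \<open>\<phi>\<close> is an isomorphism for all four structure maps, and the bialgebra axioms for \<open>R # B\<close> follow
  by transport from \<open>A\<close>. For assertion a), triviality of the right action means
  \<open>\<pi>(b r) = b \<epsilon>(r)\<close>; this is left linearity of \<open>\<pi>\<close> on \<open>R\<close>, and linearity on \<open>R\<close> extends to all
  elements \<open>r b'\<close>, that is to \<open>A\<close>, because \<open>\<pi>\<close> is right linear.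

  The calculations take place in a category that is not strict. Coherence enters through two
  formulas for the exchange of the middle factors of \<open>(W \<otimes> X) \<otimes> (Y \<otimes> Z)\<close> when one factor is the
  unit object; they express how the unit constraints interact with associativity and braiding.
\<close>

section \<open>Morphisms with explicit source and target\<close>

text \<open>
  Hom-sets may overlap, so a morphism does not determine its source and target, and conditions such
  as composability are not accessible to rewriting. An arrow carries its source and target, which
  turns these conditions into equations between objects that the simplifier computes.
\<close>

datatype ('o, 'm) arrow = Arrow (src: 'o) (mor: 'm) (trg: 'o)

context braided_monoidal_category
begin

definition arr :: "('a, 'b) arrow \<Rightarrow> bool" where
  "arr F \<longleftrightarrow> mor F \<in> Hom (src F) (trg F)"

definition comp_arrow :: "('a, 'b) arrow \<Rightarrow> ('a, 'b) arrow \<Rightarrow> ('a, 'b) arrow"  (infixr "\<bullet>" 55) where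
  "F \<bullet> G = Arrow (src G) (mor F \<cdot> mor G) (trg F)"

definition tensor_arrow :: "('a, 'b) arrow \<Rightarrow> ('a, 'b) arrow \<Rightarrow> ('a, 'b) arrow"  (infixr "\<boxtimes>" 60) where
  "F \<boxtimes> G = Arrow (src F \<odot> src G) (mor F \<otimes> mor G) (trg F \<odot> trg G)"

definition Id :: "'a \<Rightarrow> ('a, 'b) arrow" where
  "Id X = Arrow X \<langle>X\<rangle> X"

definition \<alpha> :: "'a \<Rightarrow> 'a \<Rightarrow> 'a \<Rightarrow> ('a, 'b) arrow" where
  "\<alpha> X Y Z = Arrow ((X \<odot> Y) \<odot> Z) (assoc X Y Z) (X \<odot> (Y \<odot> Z))"

definition \<alpha>' :: "'a \<Rightarrow> 'a \<Rightarrow> 'a \<Rightarrow> ('a, 'b) arrow" where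
  "\<alpha>' X Y Z = Arrow (X \<odot> (Y \<odot> Z)) (assoc_inv X Y Z) ((X \<odot> Y) \<odot> Z)"

definition \<l> :: "'a \<Rightarrow> ('a, 'b) arrow" where
  "\<l> X = Arrow (\<one> \<odot> X) (lunit X) X"

definition \<l>' :: "'a \<Rightarrow> ('a, 'b) arrow" where
  "\<l>' X = Arrow X (inverse M (\<one> \<odot> X) X (lunit X)) (\<one> \<odot> X)"

definition \<r> :: "'a \<Rightarrow> ('a, 'b) arrow" where
  "\<r> X = Arrow (X \<odot> \<one>) (runit X) X"

definition \<r>' :: "'a \<Rightarrow> ('a, 'b) arrow" where
  "\<r>' X = Arrow X (runit_inv X) (X \<odot> \<one>)"

definition \<gamma> :: "'a \<Rightarrow> 'a \<Rightarrow> ('a, 'b) arrow" where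
  "\<gamma> X Y = Arrow (X \<odot> Y) (braid X Y) (Y \<odot> X)"

definition \<gamma>' :: "'a \<Rightarrow> 'a \<Rightarrow> ('a, 'b) arrow" where
  "\<gamma>' X Y = Arrow (Y \<odot> X) (inverse M (X \<odot> Y) (Y \<odot> X) (braid X Y)) (X \<odot> Y)"

lemmas arrow_defs = arr_def comp_arrow_def tensor_arrow_def Id_def
  \<alpha>_def \<alpha>'_def \<l>_def \<l>'_def \<r>_def \<r>'_def \<gamma>_def \<gamma>'_def

lemma inverse_pair_inverse:
  assumes "is_iso M X Y f"
  shows "inverse_pair M X Y f (inverse M X Y f)"
proof -
  from assms obtain g where f: "f \<in> Hom X Y" and g: "inverse_pair M X Y f g"
    unfolding is_iso_def by blast
  have "h = g" if "inverse_pair M X Y f h" for h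
  proof -
    have "h = h \<cdot> (f \<cdot> g)"
      using g that comp_ident by (metis inverse_pair_def)
    also have "\<dots> = (h \<cdot> f) \<cdot> g"
      using f g that comp_assoc by (metis inverse_pair_def)
    also have "\<dots> = g"
      using g that ident_comp by (metis inverse_pair_def)
    finally show ?thesis .
  qed
  then show ?thesis
    unfolding inverse_def using g by (blast intro: theI2)
qed

lemma src_trg [simp]:
  "src (F \<bullet> G) = src G" "trg (F \<bullet> G) = trg F"
  "src (F \<boxtimes> G) = src F \<odot> src G" "trg (F \<boxtimes> G) = trg F \<odot> trg G"
  "src (Id X) = X" "trg (Id X) = X"
  "src (\<alpha> X Y Z) = (X \<odot> Y) \<odot> Z" "trg (\<alpha> X Y Z) = X \<odot> (Y \<odot> Z)"
  "src (\<alpha>' X Y Z) = X \<odot> (Y \<odot> Z)" "trg (\<alpha>' X Y Z) = (X \<odot> Y) \<odot> Z"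
  "src (\<l> X) = \<one> \<odot> X" "trg (\<l> X) = X"
  "src (\<l>' X) = X" "trg (\<l>' X) = \<one> \<odot> X"
  "src (\<r> X) = X \<odot> \<one>" "trg (\<r> X) = X"
  "src (\<r>' X) = X" "trg (\<r>' X) = X \<odot> \<one>"
  "src (\<gamma> X Y) = X \<odot> Y" "trg (\<gamma> X Y) = Y \<odot> X"
  "src (\<gamma>' X Y) = Y \<odot> X" "trg (\<gamma>' X Y) = X \<odot> Y"
  by (simp_all add: arrow_defs)

lemma arr_comp [simp]: "\<lbrakk>arr F; arr G; src F = trg G\<rbrakk> \<Longrightarrow> arr (F \<bullet> G)"
  by (auto simp: arrow_defs intro: comp_in)

lemma arr_tensor [simp]: "\<lbrakk>arr F; arr G\<rbrakk> \<Longrightarrow> arr (F \<boxtimes> G)"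
  by (simp add: arrow_defs tensor_in)

lemmas constraint_inverse_pair =
  assoc_iso [THEN inverse_pair_inverse, folded assoc_inv_def]
  lunit_iso [THEN inverse_pair_inverse]
  runit_iso [THEN inverse_pair_inverse, folded runit_inv_def]
  braid_iso [THEN inverse_pair_inverse]

lemma arr_constraint [simp]:
  "arr (Id X)"
  "arr (\<alpha> X Y Z)" "arr (\<alpha>' X Y Z)" "arr (\<l> X)" "arr (\<l>' X)"
  "arr (\<r> X)" "arr (\<r>' X)" "arr (\<gamma> X Y)" "arr (\<gamma>' X Y)"
  using assoc_iso lunit_iso runit_iso braid_iso constraint_inverse_pair ident_in
  by (simp_all add: arrow_defs is_iso_def inverse_pair_def)

lemma constraint_inverse [simp]:
  "\<alpha> X Y Z \<bullet> \<alpha>' X Y Z = Id (X \<odot> (Y \<odot> Z))" "\<alpha>' X Y Z \<bullet> \<alpha> X Y Z = Id ((X \<odot> Y) \<odot> Z)"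
  "\<l> X \<bullet> \<l>' X = Id X" "\<l>' X \<bullet> \<l> X = Id (\<one> \<odot> X)"
  "\<r> X \<bullet> \<r>' X = Id X" "\<r>' X \<bullet> \<r> X = Id (X \<odot> \<one>)"
  "\<gamma> X Y \<bullet> \<gamma>' X Y = Id (Y \<odot> X)" "\<gamma>' X Y \<bullet> \<gamma> X Y = Id (X \<odot> Y)"
  using constraint_inverse_pair by (simp_all add: arrow_defs inverse_pair_def)

lemma comp_arrow_assoc [simp]:
  "\<lbrakk>arr F; arr G; arr H; src F = trg G; src G = trg H\<rbrakk> \<Longrightarrow> (F \<bullet> G) \<bullet> H = F \<bullet> G \<bullet> H"
  using comp_assoc by (simp add: arrow_defs)

lemma comp_Id [simp]: "\<lbrakk>arr F; src F = X\<rbrakk> \<Longrightarrow> F \<bullet> Id X = F"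
  by (cases F) (auto simp: arrow_defs comp_ident)

lemma Id_comp [simp]: "\<lbrakk>arr F; trg F = X\<rbrakk> \<Longrightarrow> Id X \<bullet> F = F"
  by (cases F) (auto simp: arrow_defs ident_comp)

lemma Id_tensor [simp]: "Id X \<boxtimes> Id Y = Id (X \<odot> Y)"
  by (simp add: arrow_defs tensor_ident)

lemma interchange:
  "\<lbrakk>arr F; arr F'; arr G; arr G'; src G = trg F; src G' = trg F'\<rbrakk>
    \<Longrightarrow> (G \<boxtimes> G') \<bullet> (F \<boxtimes> F') = (G \<bullet> F) \<boxtimes> (G' \<bullet> F')"
  by (simp add: arrow_defs tensor_comp)

text \<open>
  Composites are kept nested to the right. An equation for a composite of two or three arrows applies
  inside such a chain only after the remainder of the chain has been put behind both sides.
\<close>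

lemma reassoc:
  "\<lbrakk>F \<bullet> G = H; arr F; arr G; arr K; src F = trg G; src G = trg K\<rbrakk> \<Longrightarrow> F \<bullet> G \<bullet> K = H \<bullet> K"
  by (simp flip: comp_arrow_assoc)

lemma reassoc3:
  "\<lbrakk>F \<bullet> G \<bullet> H = K; arr F; arr G; arr H; arr L; src F = trg G; src G = trg H; src H = trg L\<rbrakk>
    \<Longrightarrow> F \<bullet> G \<bullet> H \<bullet> L = K \<bullet> L"
  by (simp flip: comp_arrow_assoc)

text \<open>
  A calculation alternates between naturality, which moves tensor products past constraints, and
  \<open>merge\<close>, which fuses adjacent tensor products into one. The two are kept in separate rewriting
  steps where fusing would hide the left-hand side of a naturality rule. Likewise, the rule
  \<open>Id_tensor\<close> is switched off where an identity has to be read as a tensor product of identities.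
\<close>

lemmas merge = interchange reassoc [OF interchange]
lemmas constraint_cancel [simp] = constraint_inverse [THEN reassoc]

lemma \<alpha>_natural:
  "\<lbrakk>arr F; arr G; arr H; trg F = X; trg G = Y; trg H = Z\<rbrakk>
    \<Longrightarrow> \<alpha> X Y Z \<bullet> ((F \<boxtimes> G) \<boxtimes> H) = (F \<boxtimes> (G \<boxtimes> H)) \<bullet> \<alpha> (src F) (src G) (src H)"
  using assoc_natural by (auto simp: arrow_defs)

lemma \<l>_natural: "\<lbrakk>arr F; trg F = X\<rbrakk> \<Longrightarrow> \<l> X \<bullet> (Id \<one> \<boxtimes> F) = F \<bullet> \<l> (src F)"
  using lunit_natural by (auto simp: arrow_defs)

lemma \<r>_natural: "\<lbrakk>arr F; trg F = X\<rbrakk> \<Longrightarrow> \<r> X \<bullet> (F \<boxtimes> Id \<one>) = F \<bullet> \<r> (src F)"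
  using runit_natural by (auto simp: arrow_defs)

lemma \<gamma>_natural:
  "\<lbrakk>arr F; arr G; trg F = X; trg G = Y\<rbrakk> \<Longrightarrow> \<gamma> X Y \<bullet> (F \<boxtimes> G) = (G \<boxtimes> F) \<bullet> \<gamma> (src F) (src G)"
  using braid_natural by (auto simp: arrow_defs)

lemma cancel_epi:
  assumes "F \<bullet> G = F' \<bullet> G" "G \<bullet> K = Id X"
    and "arr F" "arr F'" "arr G" "arr K" "src F = X" "src F' = X" "trg G = X" "trg K = src G"
  shows "F = F'"
proof -
  have "(F \<bullet> G) \<bullet> K = (F' \<bullet> G) \<bullet> K"
    by (simp only: assms(1))
  with assms(2-) show ?thesis by simp
qed

lemma cancel_mono:
  assumes "G \<bullet> F = G \<bullet> F'" "K \<bullet> G = Id X"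
    and "arr F" "arr F'" "arr G" "arr K" "trg F = X" "trg F' = X" "src G = X" "src K = trg G"
  shows "F = F'"
proof -
  have "K \<bullet> (G \<bullet> F) = K \<bullet> (G \<bullet> F')"
    by (simp only: assms(1))
  with assms(2-) show ?thesis by (simp flip: comp_arrow_assoc)
qed

lemma \<alpha>'_natural:
  assumes "arr F" "arr G" "arr H" "trg F = X" "trg G = Y" "trg H = Z"
  shows "\<alpha>' X Y Z \<bullet> (F \<boxtimes> (G \<boxtimes> H)) = ((F \<boxtimes> G) \<boxtimes> H) \<bullet> \<alpha>' (src F) (src G) (src H)"
  by (rule cancel_mono [where G = "\<alpha> X Y Z" and K = "\<alpha>' X Y Z"])
    (use assms in \<open>simp_all add: reassoc [OF \<alpha>_natural]\<close>)

lemma \<r>'_natural: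
  assumes "arr F"
  shows "\<r>' (trg F) \<bullet> F = (F \<boxtimes> Id \<one>) \<bullet> \<r>' (src F)"
  by (rule cancel_mono [where G = "\<r> (trg F)" and K = "\<r>' (trg F)"])
    (use assms in \<open>simp_all add: reassoc [OF \<r>_natural]\<close>)

section \<open>Coherence of units\<close>

lemma pentagon_arrow:
  "(Id W \<boxtimes> \<alpha> X Y Z) \<bullet> \<alpha> W (X \<odot> Y) Z \<bullet> (\<alpha> W X Y \<boxtimes> Id Z) = \<alpha> W X (Y \<odot> Z) \<bullet> \<alpha> (W \<odot> X) Y Z"
proof -
  have "((Id W \<boxtimes> \<alpha> X Y Z) \<bullet> \<alpha> W (X \<odot> Y) Z) \<bullet> (\<alpha> W X Y \<boxtimes> Id Z)
      = \<alpha> W X (Y \<odot> Z) \<bullet> \<alpha> (W \<odot> X) Y Z"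
    unfolding comp_arrow_def tensor_arrow_def Id_def \<alpha>_def by (simp add: pentagon)
  then show ?thesis by simp
qed

lemma triangle_arrow: "(Id X \<boxtimes> \<l> Y) \<bullet> \<alpha> X \<one> Y = \<r> X \<boxtimes> Id Y"
  by (simp add: arrow_defs triangle)

lemma triangle_arrow': "(\<r> X \<boxtimes> Id Y) \<bullet> \<alpha>' X \<one> Y = Id X \<boxtimes> \<l> Y"
  by (simp flip: triangle_arrow)

lemma tensor_one_left_faithful:
  assumes "Id \<one> \<boxtimes> F = Id \<one> \<boxtimes> F'" "arr F" "arr F'" "src F = src F'" "trg F = trg F'"
  shows "F = F'"
proof (rule cancel_epi [where G = "\<l> (src F)" and K = "\<l>' (src F)"])
  show "F \<bullet> \<l> (src F) = F' \<bullet> \<l> (src F)"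
    using \<l>_natural [of F] \<l>_natural [of F'] assms by metis
qed (use assms in simp_all)

lemma tensor_one_right_faithful:
  assumes "F \<boxtimes> Id \<one> = F' \<boxtimes> Id \<one>" "arr F" "arr F'" "src F = src F'" "trg F = trg F'"
  shows "F = F'"
proof (rule cancel_epi [where G = "\<r> (src F)" and K = "\<r>' (src F)"])
  show "F \<bullet> \<r> (src F) = F' \<bullet> \<r> (src F)"
    using \<r>_natural [of F] \<r>_natural [of F'] assms by metis
qed (use assms in simp_all)

text \<open>
  Kelly's argument: after tensoring with the unit from the left, both sides become equal by the
  pentagon with two unit factors, by the triangle, and by naturality of the associativity.
\<close>

lemma \<l>_tensor: "\<l> (X \<odot> Y) \<bullet> \<alpha> \<one> X Y = \<l> X \<boxtimes> Id Y"
proof (rule tensor_one_left_faithful)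
  let ?e = "\<alpha> \<one> (\<one> \<odot> X) Y \<bullet> (\<alpha> \<one> \<one> X \<boxtimes> Id Y)"
  show "Id \<one> \<boxtimes> (\<l> (X \<odot> Y) \<bullet> \<alpha> \<one> X Y) = Id \<one> \<boxtimes> (\<l> X \<boxtimes> Id Y)"
  proof (rule cancel_epi [where G = ?e and K = "(\<alpha>' \<one> \<one> X \<boxtimes> Id Y) \<bullet> \<alpha>' \<one> (\<one> \<odot> X) Y"])
    have "(Id \<one> \<boxtimes> (\<l> (X \<odot> Y) \<bullet> \<alpha> \<one> X Y)) \<bullet> ?e
        = (Id \<one> \<boxtimes> \<l> (X \<odot> Y)) \<bullet> (Id \<one> \<boxtimes> \<alpha> \<one> X Y) \<bullet> ?e"
      by (simp add: merge)
    also have "\<dots> = (Id \<one> \<boxtimes> \<l> (X \<odot> Y)) \<bullet> \<alpha> \<one> \<one> (X \<odot> Y) \<bullet> \<alpha> (\<one> \<odot> \<one>) X Y"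
      by (simp add: pentagon_arrow)
    also have "\<dots> = (\<r> \<one> \<boxtimes> (Id X \<boxtimes> Id Y)) \<bullet> \<alpha> (\<one> \<odot> \<one>) X Y"
      by (simp add: reassoc [OF triangle_arrow])
    also have "\<dots> = \<alpha> \<one> X Y \<bullet> ((\<r> \<one> \<boxtimes> Id X) \<boxtimes> Id Y)"
      by (simp add: \<alpha>_natural del: Id_tensor)
    also have "\<dots> = \<alpha> \<one> X Y \<bullet> ((Id \<one> \<boxtimes> \<l> X) \<boxtimes> Id Y) \<bullet> (\<alpha> \<one> \<one> X \<boxtimes> Id Y)"
      by (simp add: merge triangle_arrow)
    also have "\<dots> = (Id \<one> \<boxtimes> (\<l> X \<boxtimes> Id Y)) \<bullet> ?e"
      by (simp add: reassoc [OF \<alpha>_natural])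
    finally show "(Id \<one> \<boxtimes> (\<l> (X \<odot> Y) \<bullet> \<alpha> \<one> X Y)) \<bullet> ?e = (Id \<one> \<boxtimes> (\<l> X \<boxtimes> Id Y)) \<bullet> ?e" .
  qed (simp_all add: merge)
qed simp_all

lemma \<r>_tensor: "(Id X \<boxtimes> \<r> Y) \<bullet> \<alpha> X Y \<one> = \<r> (X \<odot> Y)"
proof (rule tensor_one_right_faithful)
  show "((Id X \<boxtimes> \<r> Y) \<bullet> \<alpha> X Y \<one>) \<boxtimes> Id \<one> = \<r> (X \<odot> Y) \<boxtimes> Id \<one>"
  proof (rule cancel_mono [where G = "\<alpha> X Y \<one>" and K = "\<alpha>' X Y \<one>"])
    have "\<alpha> X Y \<one> \<bullet> (((Id X \<boxtimes> \<r> Y) \<bullet> \<alpha> X Y \<one>) \<boxtimes> Id \<one>)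
        = \<alpha> X Y \<one> \<bullet> ((Id X \<boxtimes> \<r> Y) \<boxtimes> Id \<one>) \<bullet> (\<alpha> X Y \<one> \<boxtimes> Id \<one>)"
      by (simp add: merge)
    also have "\<dots> = (Id X \<boxtimes> (\<r> Y \<boxtimes> Id \<one>)) \<bullet> \<alpha> X (Y \<odot> \<one>) \<one> \<bullet> (\<alpha> X Y \<one> \<boxtimes> Id \<one>)"
      by (simp add: reassoc [OF \<alpha>_natural])
    also have "\<dots> = (Id X \<boxtimes> (Id Y \<boxtimes> \<l> \<one>)) \<bullet> (Id X \<boxtimes> \<alpha> Y \<one> \<one>) \<bullet> \<alpha> X (Y \<odot> \<one>) \<one> \<bullet> (\<alpha> X Y \<one> \<boxtimes> Id \<one>)"
      by (simp add: merge triangle_arrow)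
    also have "\<dots> = (Id X \<boxtimes> (Id Y \<boxtimes> \<l> \<one>)) \<bullet> \<alpha> X Y (\<one> \<odot> \<one>) \<bullet> \<alpha> (X \<odot> Y) \<one> \<one>"
      by (simp add: pentagon_arrow)
    also have "\<dots> = \<alpha> X Y \<one> \<bullet> ((Id X \<boxtimes> Id Y) \<boxtimes> \<l> \<one>) \<bullet> \<alpha> (X \<odot> Y) \<one> \<one>"
      by (simp add: reassoc [OF \<alpha>_natural] del: Id_tensor)
    also have "\<dots> = \<alpha> X Y \<one> \<bullet> (\<r> (X \<odot> Y) \<boxtimes> Id \<one>)"
      by (simp add: triangle_arrow)
    finally show "\<alpha> X Y \<one> \<bullet> (((Id X \<boxtimes> \<r> Y) \<bullet> \<alpha> X Y \<one>) \<boxtimes> Id \<one>)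
        = \<alpha> X Y \<one> \<bullet> (\<r> (X \<odot> Y) \<boxtimes> Id \<one>)" .
  qed simp_all
qed simp_all

lemma \<l>_tensor': "(\<l> X \<boxtimes> Id Y) \<bullet> \<alpha>' \<one> X Y = \<l> (X \<odot> Y)"
  by (simp flip: \<l>_tensor)

lemma \<r>_tensor': "\<r> (X \<odot> Y) \<bullet> \<alpha>' X Y \<one> = Id X \<boxtimes> \<r> Y"
  by (simp flip: \<r>_tensor)

lemma \<l>_one: "\<l> \<one> = \<r> \<one>"
proof (rule tensor_one_right_faithful)
  have "\<l> (\<one> \<odot> \<one>) = Id \<one> \<boxtimes> \<l> \<one>"
    by (rule cancel_mono [where G = "\<l> \<one>" and K = "\<l>' \<one>"]) (simp_all add: \<l>_natural)
  then show "\<l> \<one> \<boxtimes> Id \<one> = \<r> \<one> \<boxtimes> Id \<one>"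
    by (simp flip: \<l>_tensor triangle_arrow)
qed simp_all

text \<open>
  The hexagon factors the braiding of \<open>\<one> \<odot> \<one>\<close> with \<open>Z\<close> into two copies of \<open>\<gamma> \<one> Z\<close>. By naturality
  with respect to \<open>\<r> \<one>\<close> it equals a single copy up to unit constraints, and cancelling one copy
  leaves the claim.
\<close>

lemma \<r>_\<gamma>_one: "\<r> Z \<bullet> \<gamma> \<one> Z = \<l> Z"
proof (rule tensor_one_left_faithful)
  have hexagon: "\<gamma> (\<one> \<odot> \<one>) Z
      = \<alpha> Z \<one> \<one> \<bullet> (\<gamma> \<one> Z \<boxtimes> Id \<one>) \<bullet> \<alpha>' \<one> Z \<one> \<bullet> (Id \<one> \<boxtimes> \<gamma> \<one> Z) \<bullet> \<alpha> \<one> \<one> Z"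
  proof -
    have "\<gamma> (\<one> \<odot> \<one>) Z
      = (((\<alpha> Z \<one> \<one> \<bullet> (\<gamma> \<one> Z \<boxtimes> Id \<one>)) \<bullet> \<alpha>' \<one> Z \<one>) \<bullet> (Id \<one> \<boxtimes> \<gamma> \<one> Z)) \<bullet> \<alpha> \<one> \<one> Z"
      unfolding comp_arrow_def tensor_arrow_def Id_def \<alpha>_def \<alpha>'_def \<gamma>_def
      by (simp add: braid_tensor_left)
    then show ?thesis by simp
  qed
  show "Id \<one> \<boxtimes> (\<r> Z \<bullet> \<gamma> \<one> Z) = Id \<one> \<boxtimes> \<l> Z"
  proof (rule cancel_mono [where G = "\<gamma> \<one> Z" and K = "\<gamma>' \<one> Z"])
    show "\<gamma> \<one> Z \<bullet> (Id \<one> \<boxtimes> (\<r> Z \<bullet> \<gamma> \<one> Z)) = \<gamma> \<one> Z \<bullet> (Id \<one> \<boxtimes> \<l> Z)"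
    proof (rule cancel_epi [where G = "\<alpha> \<one> \<one> Z" and K = "\<alpha>' \<one> \<one> Z"])
      have "(\<gamma> \<one> Z \<bullet> (Id \<one> \<boxtimes> (\<r> Z \<bullet> \<gamma> \<one> Z))) \<bullet> \<alpha> \<one> \<one> Z
          = \<gamma> \<one> Z \<bullet> (Id \<one> \<boxtimes> \<r> Z) \<bullet> (Id \<one> \<boxtimes> \<gamma> \<one> Z) \<bullet> \<alpha> \<one> \<one> Z"
        by (simp add: merge)
      also have "\<dots> = \<gamma> \<one> Z \<bullet> \<r> (\<one> \<odot> Z) \<bullet> \<alpha>' \<one> Z \<one> \<bullet> (Id \<one> \<boxtimes> \<gamma> \<one> Z) \<bullet> \<alpha> \<one> \<one> Z"
        by (simp flip: \<r>_tensor)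
      also have "\<dots> = \<r> (Z \<odot> \<one>) \<bullet> (\<gamma> \<one> Z \<boxtimes> Id \<one>) \<bullet> \<alpha>' \<one> Z \<one> \<bullet> (Id \<one> \<boxtimes> \<gamma> \<one> Z) \<bullet> \<alpha> \<one> \<one> Z"
        by (simp add: reassoc [OF \<r>_natural])
      also have "\<dots> = (Id Z \<boxtimes> \<r> \<one>) \<bullet> \<gamma> (\<one> \<odot> \<one>) Z"
        by (simp add: hexagon flip: \<r>_tensor)
      also have "\<dots> = \<gamma> \<one> Z \<bullet> (\<r> \<one> \<boxtimes> Id Z)"
        by (simp add: \<gamma>_natural)
      also have "\<dots> = (\<gamma> \<one> Z \<bullet> (Id \<one> \<boxtimes> \<l> Z)) \<bullet> \<alpha> \<one> \<one> Z"
        by (simp add: triangle_arrow)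
      finally show "(\<gamma> \<one> Z \<bullet> (Id \<one> \<boxtimes> (\<r> Z \<bullet> \<gamma> \<one> Z))) \<bullet> \<alpha> \<one> \<one> Z
          = (\<gamma> \<one> Z \<bullet> (Id \<one> \<boxtimes> \<l> Z)) \<bullet> \<alpha> \<one> \<one> Z" .
    qed simp_all
  qed simp_all
qed simp_all

section \<open>The exchange of the middle factors\<close>

text \<open>
  These are \<open>to_mid\<close> and \<open>from_mid\<close>; \<open>\<tau>\<close> exchanges the two middle factors by the braiding, so that
  \<open>\<tau> X X Y Y\<close> enters the tensor product comultiplication on \<open>X \<odot> Y\<close>.
\<close>

definition \<kappa> :: "'a \<Rightarrow> 'a \<Rightarrow> 'a \<Rightarrow> 'a \<Rightarrow> ('a, 'b) arrow" where
  "\<kappa> W X Y Z = (Id W \<boxtimes> \<alpha>' X Y Z) \<bullet> \<alpha> W X (Y \<odot> Z)"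

definition \<kappa>' :: "'a \<Rightarrow> 'a \<Rightarrow> 'a \<Rightarrow> 'a \<Rightarrow> ('a, 'b) arrow" where
  "\<kappa>' W X Y Z = \<alpha>' W X (Y \<odot> Z) \<bullet> (Id W \<boxtimes> \<alpha> X Y Z)"

definition \<tau> :: "'a \<Rightarrow> 'a \<Rightarrow> 'a \<Rightarrow> 'a \<Rightarrow> ('a, 'b) arrow" where
  "\<tau> W X Y Z = \<kappa>' W Y X Z \<bullet> (Id W \<boxtimes> (\<gamma> X Y \<boxtimes> Id Z)) \<bullet> \<kappa> W X Y Z"

lemma \<kappa>_\<tau>_simps [simp]:
  "arr (\<kappa> W X Y Z)" "arr (\<kappa>' W X Y Z)" "arr (\<tau> W X Y Z)"
  "src (\<kappa> W X Y Z) = (W \<odot> X) \<odot> (Y \<odot> Z)" "trg (\<kappa> W X Y Z) = W \<odot> ((X \<odot> Y) \<odot> Z)"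
  "trg (\<kappa>' W X Y Z) = (W \<odot> X) \<odot> (Y \<odot> Z)" "src (\<kappa>' W X Y Z) = W \<odot> ((X \<odot> Y) \<odot> Z)"
  "src (\<tau> W X Y Z) = (W \<odot> X) \<odot> (Y \<odot> Z)" "trg (\<tau> W X Y Z) = (W \<odot> Y) \<odot> (X \<odot> Z)"
  by (simp_all add: \<kappa>_def \<kappa>'_def \<tau>_def)

lemma \<kappa>_inverse [simp]:
  "\<kappa> W X Y Z \<bullet> \<kappa>' W X Y Z = Id (W \<odot> ((X \<odot> Y) \<odot> Z))"
  "\<kappa>' W X Y Z \<bullet> \<kappa> W X Y Z = Id ((W \<odot> X) \<odot> (Y \<odot> Z))"
  by (simp_all add: \<kappa>_def \<kappa>'_def merge)

lemmas \<kappa>_cancel [simp] = \<kappa>_inverse [THEN reassoc]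

lemma \<kappa>_natural:
  assumes "arr F" "arr G" "arr H" "arr K" "trg F = W" "trg G = X" "trg H = Y" "trg K = Z"
  shows "\<kappa> W X Y Z \<bullet> ((F \<boxtimes> G) \<boxtimes> (H \<boxtimes> K))
    = (F \<boxtimes> ((G \<boxtimes> H) \<boxtimes> K)) \<bullet> \<kappa> (src F) (src G) (src H) (src K)"
  using assms by (simp add: \<kappa>_def \<alpha>_natural merge \<alpha>'_natural)

lemma \<kappa>'_natural:
  assumes "arr F" "arr G" "arr H" "arr K" "trg F = W" "trg G = X" "trg H = Y" "trg K = Z"
  shows "\<kappa>' W X Y Z \<bullet> (F \<boxtimes> ((G \<boxtimes> H) \<boxtimes> K))
    = ((F \<boxtimes> G) \<boxtimes> (H \<boxtimes> K)) \<bullet> \<kappa>' (src F) (src G) (src H) (src K)"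
  by (rule cancel_mono [where G = "\<kappa> W X Y Z" and K = "\<kappa>' W X Y Z"])
    (use assms in \<open>simp_all add: reassoc [OF \<kappa>_natural]\<close>)

lemma \<tau>_natural:
  assumes "arr F" "arr G" "arr H" "arr K" "trg F = W" "trg G = X" "trg H = Y" "trg K = Z"
  shows "\<tau> W X Y Z \<bullet> ((F \<boxtimes> G) \<boxtimes> (H \<boxtimes> K))
    = ((F \<boxtimes> H) \<boxtimes> (G \<boxtimes> K)) \<bullet> \<tau> (src F) (src G) (src H) (src K)"
proof -
  have mid: "(Id W \<boxtimes> (\<gamma> X Y \<boxtimes> Id Z)) \<bullet> (F \<boxtimes> ((G \<boxtimes> H) \<boxtimes> K))
      = (F \<boxtimes> ((H \<boxtimes> G) \<boxtimes> K)) \<bullet> (Id (src F) \<boxtimes> (\<gamma> (src G) (src H) \<boxtimes> Id (src K)))"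
    using assms by (simp add: merge \<gamma>_natural)
  then show ?thesis
    using assms by (simp add: \<tau>_def \<kappa>_natural reassoc [OF mid] reassoc [OF \<kappa>'_natural])
qed

text \<open>
  With the unit in the second place the exchange only regroups, since braiding with the unit is trivial.
\<close>

lemma \<tau>_one_second:
  "(Id (X \<odot> Y) \<boxtimes> \<l> Y') \<bullet> \<tau> X \<one> Y Y' = \<alpha>' X Y Y' \<bullet> (\<r> X \<boxtimes> Id (Y \<odot> Y'))"
proof -
  have "(Id (X \<odot> Y) \<boxtimes> \<l> Y') \<bullet> \<tau> X \<one> Y Y'
      = (((Id X \<boxtimes> Id Y) \<boxtimes> \<l> Y') \<bullet> \<alpha>' X Y (\<one> \<odot> Y')) \<bullet> (Id X \<boxtimes> \<alpha> Y \<one> Y')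
        \<bullet> (Id X \<boxtimes> (\<gamma> \<one> Y \<boxtimes> Id Y')) \<bullet> (Id X \<boxtimes> \<alpha>' \<one> Y Y') \<bullet> \<alpha> X \<one> (Y \<odot> Y')"
    by (simp add: \<tau>_def \<kappa>_def \<kappa>'_def)
  also have "((Id X \<boxtimes> Id Y) \<boxtimes> \<l> Y') \<bullet> \<alpha>' X Y (\<one> \<odot> Y') = \<alpha>' X Y Y' \<bullet> (Id X \<boxtimes> (Id Y \<boxtimes> \<l> Y'))"
    by (simp add: \<alpha>'_natural del: Id_tensor)
  also have "(\<alpha>' X Y Y' \<bullet> (Id X \<boxtimes> (Id Y \<boxtimes> \<l> Y'))) \<bullet> (Id X \<boxtimes> \<alpha> Y \<one> Y')
        \<bullet> (Id X \<boxtimes> (\<gamma> \<one> Y \<boxtimes> Id Y')) \<bullet> (Id X \<boxtimes> \<alpha>' \<one> Y Y') \<bullet> \<alpha> X \<one> (Y \<odot> Y')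
      = \<alpha>' X Y Y' \<bullet> (Id X \<boxtimes> (((Id Y \<boxtimes> \<l> Y') \<bullet> \<alpha> Y \<one> Y')
        \<bullet> (\<gamma> \<one> Y \<boxtimes> Id Y') \<bullet> \<alpha>' \<one> Y Y')) \<bullet> \<alpha> X \<one> (Y \<odot> Y')"
    by (simp add: merge)
  also have "((Id Y \<boxtimes> \<l> Y') \<bullet> \<alpha> Y \<one> Y') \<bullet> (\<gamma> \<one> Y \<boxtimes> Id Y') \<bullet> \<alpha>' \<one> Y Y' = \<l> (Y \<odot> Y')"
    by (simp only: triangle_arrow) (simp add: merge \<r>_\<gamma>_one \<l>_tensor')
  also have "\<alpha>' X Y Y' \<bullet> (Id X \<boxtimes> \<l> (Y \<odot> Y')) \<bullet> \<alpha> X \<one> (Y \<odot> Y') = \<alpha>' X Y Y' \<bullet> (\<r> X \<boxtimes> Id (Y \<odot> Y'))"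
    by (simp add: triangle_arrow)
  finally show ?thesis .
qed

text \<open>
  With the unit in the fourth place the exchange is the bare braiding of \<open>X'\<close> with \<open>Y\<close>.
\<close>

lemma \<tau>_one_fourth:
  "(Id (X \<odot> Y) \<boxtimes> \<r> X') \<bullet> \<tau> X X' Y \<one>
    = \<alpha>' X Y X' \<bullet> (Id X \<boxtimes> \<gamma> X' Y) \<bullet> \<alpha> X X' Y \<bullet> (Id (X \<odot> X') \<boxtimes> \<r> Y)"
proof -
  have "(Id (X \<odot> Y) \<boxtimes> \<r> X') \<bullet> \<tau> X X' Y \<one>
      = (((Id X \<boxtimes> Id Y) \<boxtimes> \<r> X') \<bullet> \<alpha>' X Y (X' \<odot> \<one>)) \<bullet> (Id X \<boxtimes> \<alpha> Y X' \<one>)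
        \<bullet> (Id X \<boxtimes> (\<gamma> X' Y \<boxtimes> Id \<one>)) \<bullet> (Id X \<boxtimes> \<alpha>' X' Y \<one>) \<bullet> \<alpha> X X' (Y \<odot> \<one>)"
    by (simp add: \<tau>_def \<kappa>_def \<kappa>'_def)
  also have "((Id X \<boxtimes> Id Y) \<boxtimes> \<r> X') \<bullet> \<alpha>' X Y (X' \<odot> \<one>) = \<alpha>' X Y X' \<bullet> (Id X \<boxtimes> (Id Y \<boxtimes> \<r> X'))"
    by (simp add: \<alpha>'_natural del: Id_tensor)
  also have "(\<alpha>' X Y X' \<bullet> (Id X \<boxtimes> (Id Y \<boxtimes> \<r> X'))) \<bullet> (Id X \<boxtimes> \<alpha> Y X' \<one>)
        \<bullet> (Id X \<boxtimes> (\<gamma> X' Y \<boxtimes> Id \<one>)) \<bullet> (Id X \<boxtimes> \<alpha>' X' Y \<one>) \<bullet> \<alpha> X X' (Y \<odot> \<one>)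
      = \<alpha>' X Y X' \<bullet> (Id X \<boxtimes> (((Id Y \<boxtimes> \<r> X') \<bullet> \<alpha> Y X' \<one>) \<bullet> (\<gamma> X' Y \<boxtimes> Id \<one>) \<bullet> \<alpha>' X' Y \<one>))
        \<bullet> \<alpha> X X' (Y \<odot> \<one>)"
    by (simp add: merge)
  also have "((Id Y \<boxtimes> \<r> X') \<bullet> \<alpha> Y X' \<one>) \<bullet> (\<gamma> X' Y \<boxtimes> Id \<one>) \<bullet> \<alpha>' X' Y \<one>
      = \<gamma> X' Y \<bullet> (Id X' \<boxtimes> \<r> Y)"
    by (simp only: \<r>_tensor) (simp add: reassoc [OF \<r>_natural] \<r>_tensor')
  also have "\<alpha>' X Y X' \<bullet> (Id X \<boxtimes> (\<gamma> X' Y \<bullet> (Id X' \<boxtimes> \<r> Y))) \<bullet> \<alpha> X X' (Y \<odot> \<one>)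
      = \<alpha>' X Y X' \<bullet> (Id X \<boxtimes> \<gamma> X' Y) \<bullet> (Id X \<boxtimes> (Id X' \<boxtimes> \<r> Y)) \<bullet> \<alpha> X X' (Y \<odot> \<one>)"
    by (simp add: merge)
  also have "(Id X \<boxtimes> (Id X' \<boxtimes> \<r> Y)) \<bullet> \<alpha> X X' (Y \<odot> \<one>) = \<alpha> X X' Y \<bullet> (Id (X \<odot> X') \<boxtimes> \<r> Y)"
    by (simp add: \<alpha>_natural flip: Id_tensor)
  finally show ?thesis by simp
qed

section \<open>Bialgebras and transport of structure\<close>

definition Mult :: "('a, 'b) bialg \<Rightarrow> ('a, 'b) arrow" where
  "Mult H = Arrow (obj H \<odot> obj H) (mult H) (obj H)"

definition Unit :: "('a, 'b) bialg \<Rightarrow> ('a, 'b) arrow" where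
  "Unit H = Arrow \<one> (unit H) (obj H)"

definition Comult :: "('a, 'b) bialg \<Rightarrow> ('a, 'b) arrow" where
  "Comult H = Arrow (obj H) (comult H) (obj H \<odot> obj H)"

definition Counit :: "('a, 'b) bialg \<Rightarrow> ('a, 'b) arrow" where
  "Counit H = Arrow (obj H) (counit H) \<one>"

lemmas bialg_arrow_defs = Mult_def Unit_def Comult_def Counit_def

lemma src_trg_bialg [simp]:
  "src (Mult H) = obj H \<odot> obj H" "trg (Mult H) = obj H"
  "src (Unit H) = \<one>" "trg (Unit H) = obj H"
  "src (Comult H) = obj H" "trg (Comult H) = obj H \<odot> obj H"
  "src (Counit H) = obj H" "trg (Counit H) = \<one>"
  by (simp_all add: bialg_arrow_defs)

text \<open>
  Composites of several arrows are nested to the left, as in the defining locales, so that the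
  equivalences hold by unfolding; \<open>bialgebra_axioms\<close> restates them nested to the right.
\<close>

lemma is_algebra_iff:
  "is_algebra M H \<longleftrightarrow> arr (Mult H) \<and> arr (Unit H) \<and>
    Mult H \<bullet> (Mult H \<boxtimes> Id (obj H))
      = (Mult H \<bullet> (Id (obj H) \<boxtimes> Mult H)) \<bullet> \<alpha> (obj H) (obj H) (obj H) \<and>
    Mult H \<bullet> (Unit H \<boxtimes> Id (obj H)) = \<l> (obj H) \<and>
    Mult H \<bullet> (Id (obj H) \<boxtimes> Unit H) = \<r> (obj H)"
  by (simp add: is_algebra_def bialg_arrow_defs arrow_defs)

lemma is_coalgebra_iff:
  "is_coalgebra M H \<longleftrightarrow> arr (Comult H) \<and> arr (Counit H) \<and>
    (\<alpha> (obj H) (obj H) (obj H) \<bullet> (Comult H \<boxtimes> Id (obj H))) \<bullet> Comult H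
      = (Id (obj H) \<boxtimes> Comult H) \<bullet> Comult H \<and>
    (\<l> (obj H) \<bullet> (Counit H \<boxtimes> Id (obj H))) \<bullet> Comult H = Id (obj H) \<and>
    (\<r> (obj H) \<bullet> (Id (obj H) \<boxtimes> Counit H)) \<bullet> Comult H = Id (obj H)"
  by (simp add: is_coalgebra_def bialg_arrow_defs arrow_defs)

lemma is_bialgebra_iff:
  "is_bialgebra M H \<longleftrightarrow> is_algebra M H \<and> is_coalgebra M H \<and>
    Comult H \<bullet> Mult H
      = ((((Mult H \<boxtimes> Mult H) \<bullet> \<kappa>' (obj H) (obj H) (obj H) (obj H))
        \<bullet> (Id (obj H) \<boxtimes> (\<gamma> (obj H) (obj H) \<boxtimes> Id (obj H))))
        \<bullet> \<kappa> (obj H) (obj H) (obj H) (obj H)) \<bullet> (Comult H \<boxtimes> Comult H) \<and>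
    Counit H \<bullet> Mult H = \<l> \<one> \<bullet> (Counit H \<boxtimes> Counit H) \<and>
    Comult H \<bullet> Unit H = (Unit H \<boxtimes> Unit H) \<bullet> \<l>' \<one> \<and>
    Counit H \<bullet> Unit H = Id \<one>"
  by (simp add: is_bialgebra_def is_bialgebra_axioms_def bialg_arrow_defs arrow_defs \<kappa>_def \<kappa>'_def
      to_mid_def from_mid_def mult_one_def comult_one_def)

lemma bialgebra_arr [simp]:
  assumes "is_bialgebra M H"
  shows "arr (Mult H)" "arr (Unit H)" "arr (Comult H)" "arr (Counit H)"
  using assms by (simp_all add: is_bialgebra_iff is_algebra_iff is_coalgebra_iff)

lemma bialgebra_axioms:
  assumes H: "is_bialgebra M H"
  shows Mult_assoc: "Mult H \<bullet> (Mult H \<boxtimes> Id (obj H))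
      = Mult H \<bullet> (Id (obj H) \<boxtimes> Mult H) \<bullet> \<alpha> (obj H) (obj H) (obj H)"
    and Mult_Unit_left: "Mult H \<bullet> (Unit H \<boxtimes> Id (obj H)) = \<l> (obj H)"
    and Mult_Unit_right: "Mult H \<bullet> (Id (obj H) \<boxtimes> Unit H) = \<r> (obj H)"
    and Comult_coassoc: "\<alpha> (obj H) (obj H) (obj H) \<bullet> (Comult H \<boxtimes> Id (obj H)) \<bullet> Comult H
      = (Id (obj H) \<boxtimes> Comult H) \<bullet> Comult H"
    and Counit_left: "\<l> (obj H) \<bullet> (Counit H \<boxtimes> Id (obj H)) \<bullet> Comult H = Id (obj H)"
    and Counit_right: "\<r> (obj H) \<bullet> (Id (obj H) \<boxtimes> Counit H) \<bullet> Comult H = Id (obj H)"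
    and Comult_Mult: "Comult H \<bullet> Mult H = (Mult H \<boxtimes> Mult H)
      \<bullet> \<tau> (obj H) (obj H) (obj H) (obj H) \<bullet> (Comult H \<boxtimes> Comult H)"
    and Counit_Mult: "Counit H \<bullet> Mult H = \<l> \<one> \<bullet> (Counit H \<boxtimes> Counit H)"
    and Comult_Unit: "Comult H \<bullet> Unit H = (Unit H \<boxtimes> Unit H) \<bullet> \<l>' \<one>"
    and Counit_Unit: "Counit H \<bullet> Unit H = Id \<one>"
proof -
  note ax = H [unfolded is_bialgebra_iff is_algebra_iff is_coalgebra_iff]
  note [simp] = bialgebra_arr [OF H]
  let ?h = "obj H"
  have "Mult H \<bullet> (Mult H \<boxtimes> Id ?h) = (Mult H \<bullet> (Id ?h \<boxtimes> Mult H)) \<bullet> \<alpha> ?h ?h ?h"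
    using ax by blast
  also have "\<dots> = Mult H \<bullet> (Id ?h \<boxtimes> Mult H) \<bullet> \<alpha> ?h ?h ?h"
    by simp
  finally show "Mult H \<bullet> (Mult H \<boxtimes> Id ?h) = Mult H \<bullet> (Id ?h \<boxtimes> Mult H) \<bullet> \<alpha> ?h ?h ?h" .
  have "\<alpha> ?h ?h ?h \<bullet> (Comult H \<boxtimes> Id ?h) \<bullet> Comult H = (\<alpha> ?h ?h ?h \<bullet> (Comult H \<boxtimes> Id ?h)) \<bullet> Comult H"
    by simp
  also have "\<dots> = (Id ?h \<boxtimes> Comult H) \<bullet> Comult H"
    using ax by blast
  finally show "\<alpha> ?h ?h ?h \<bullet> (Comult H \<boxtimes> Id ?h) \<bullet> Comult H = (Id ?h \<boxtimes> Comult H) \<bullet> Comult H" .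
  have "\<l> ?h \<bullet> (Counit H \<boxtimes> Id ?h) \<bullet> Comult H = (\<l> ?h \<bullet> (Counit H \<boxtimes> Id ?h)) \<bullet> Comult H"
    by simp
  also have "\<dots> = Id ?h"
    using ax by blast
  finally show "\<l> ?h \<bullet> (Counit H \<boxtimes> Id ?h) \<bullet> Comult H = Id ?h" .
  have "\<r> ?h \<bullet> (Id ?h \<boxtimes> Counit H) \<bullet> Comult H = (\<r> ?h \<bullet> (Id ?h \<boxtimes> Counit H)) \<bullet> Comult H"
    by simp
  also have "\<dots> = Id ?h"
    using ax by blast
  finally show "\<r> ?h \<bullet> (Id ?h \<boxtimes> Counit H) \<bullet> Comult H = Id ?h" .
  have "Comult H \<bullet> Mult H = ((((Mult H \<boxtimes> Mult H) \<bullet> \<kappa>' ?h ?h ?h ?h)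
      \<bullet> (Id ?h \<boxtimes> (\<gamma> ?h ?h \<boxtimes> Id ?h))) \<bullet> \<kappa> ?h ?h ?h ?h) \<bullet> (Comult H \<boxtimes> Comult H)"
    using ax by blast
  also have "\<dots> = (Mult H \<boxtimes> Mult H) \<bullet> \<tau> ?h ?h ?h ?h \<bullet> (Comult H \<boxtimes> Comult H)"
    by (simp add: \<tau>_def)
  finally show "Comult H \<bullet> Mult H
      = (Mult H \<boxtimes> Mult H) \<bullet> \<tau> ?h ?h ?h ?h \<bullet> (Comult H \<boxtimes> Comult H)" .
qed (use H in \<open>simp_all only: is_bialgebra_iff is_algebra_iff is_coalgebra_iff\<close>)

lemma Mult_assoc_arrows:
  assumes H: "is_bialgebra M H"
    and "arr F" "arr G" "arr K" "trg F = obj H" "trg G = obj H" "trg K = obj H"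
  shows "Mult H \<bullet> ((Mult H \<bullet> (F \<boxtimes> G)) \<boxtimes> K)
    = Mult H \<bullet> (F \<boxtimes> (Mult H \<bullet> (G \<boxtimes> K))) \<bullet> \<alpha> (src F) (src G) (src K)"
proof -
  note [simp] = bialgebra_arr [OF H]
  have "Mult H \<bullet> ((Mult H \<bullet> (F \<boxtimes> G)) \<boxtimes> K) = Mult H \<bullet> (Mult H \<boxtimes> Id (obj H)) \<bullet> ((F \<boxtimes> G) \<boxtimes> K)"
    using assms by (simp add: merge)
  also have "\<dots> = Mult H \<bullet> (F \<boxtimes> (Mult H \<bullet> (G \<boxtimes> K))) \<bullet> \<alpha> (src F) (src G) (src K)"
    using assms by (simp add: reassoc [OF Mult_assoc [OF H]] \<alpha>_natural) (simp add: merge)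
  finally show ?thesis .
qed

lemma Mult_Unit_arrow:
  assumes H: "is_bialgebra M H" and "arr F" "trg F = obj H"
  shows "Mult H \<bullet> (F \<boxtimes> Unit H) = F \<bullet> \<r> (src F)"
proof -
  note [simp] = bialgebra_arr [OF H]
  have "Mult H \<bullet> (F \<boxtimes> Unit H) = Mult H \<bullet> (Id (obj H) \<boxtimes> Unit H) \<bullet> (F \<boxtimes> Id \<one>)"
    using assms by (simp add: merge)
  then show ?thesis
    using assms by (simp add: reassoc [OF Mult_Unit_right [OF H]] \<r>_natural)
qed

text \<open>
  A product \<open>(w x)(y z)\<close> is computed as \<open>w ((x y) z)\<close>: this makes the middle factors \<open>x y\<close>
  accessible, on which the smash product acts.
\<close>

lemma Mult_Mult_\<kappa>:
  assumes H: "is_bialgebra M H"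
  shows "Mult H \<bullet> (Mult H \<boxtimes> Mult H)
    = Mult H \<bullet> (Id (obj H) \<boxtimes> (Mult H \<bullet> (Mult H \<boxtimes> Id (obj H)))) \<bullet> \<kappa> (obj H) (obj H) (obj H) (obj H)"
proof -
  let ?h = "obj H"
  note [simp] = bialgebra_arr [OF H]
  have "Mult H \<bullet> (Mult H \<boxtimes> Mult H) = Mult H \<bullet> ((Mult H \<bullet> (Id ?h \<boxtimes> Id ?h)) \<boxtimes> Mult H)"
    by simp
  also have "\<dots> = Mult H \<bullet> (Id ?h \<boxtimes> (Mult H \<bullet> (Id ?h \<boxtimes> Mult H))) \<bullet> \<alpha> ?h ?h (?h \<odot> ?h)"
    by (simp only: Mult_assoc_arrows [OF H] arr_constraint src_trg bialgebra_arr [OF H] src_trg_bialg)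
  also have "Mult H \<bullet> (Id ?h \<boxtimes> Mult H) = Mult H \<bullet> (Mult H \<boxtimes> Id ?h) \<bullet> \<alpha>' ?h ?h ?h"
    by (simp add: reassoc [OF Mult_assoc [OF H]])
  finally show ?thesis by (simp add: \<kappa>_def merge)
qed

text \<open>
  Every axiom for \<open>H\<close> is the corresponding axiom for \<open>A\<close> after composition with a tensor power of \<open>F\<close>.
\<close>

lemma bialgebra_transport:
  assumes A: "is_bialgebra M A"
    and [simp]: "arr F" "src F = obj H" "trg F = obj A"
      "arr G" "src G = obj A" "trg G = obj H" "G \<bullet> F = Id (obj H)"
      "arr (Mult H)" "arr (Unit H)" "arr (Comult H)" "arr (Counit H)"
    and mult: "F \<bullet> Mult H = Mult A \<bullet> (F \<boxtimes> F)"
    and unit: "F \<bullet> Unit H = Unit A"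
    and comult: "Comult A \<bullet> F = (F \<boxtimes> F) \<bullet> Comult H"
    and counit: "Counit A \<bullet> F = Counit H"
  shows "is_bialgebra M H"
proof -
  let ?a = "obj A" and ?h = "obj H"
  note [simp] = bialgebra_arr [OF A]
  note cancel_F = cancel_mono [where G = F and K = G]
  have algebra: "is_algebra M H"
    unfolding is_algebra_iff
  proof (intro conjI)
    show "Mult H \<bullet> (Mult H \<boxtimes> Id ?h) = (Mult H \<bullet> (Id ?h \<boxtimes> Mult H)) \<bullet> \<alpha> ?h ?h ?h"
    proof (rule cancel_F)
      have "F \<bullet> Mult H \<bullet> (Mult H \<boxtimes> Id ?h) = Mult A \<bullet> (Mult A \<boxtimes> Id ?a) \<bullet> ((F \<boxtimes> F) \<boxtimes> F)"
        by (simp add: reassoc [OF mult] mult merge)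
      also have "\<dots> = Mult A \<bullet> (Id ?a \<boxtimes> Mult A) \<bullet> (F \<boxtimes> (F \<boxtimes> F)) \<bullet> \<alpha> ?h ?h ?h"
        by (simp add: reassoc [OF Mult_assoc [OF A]] \<alpha>_natural)
      also have "\<dots> = F \<bullet> (Mult H \<bullet> (Id ?h \<boxtimes> Mult H)) \<bullet> \<alpha> ?h ?h ?h"
        by (simp add: reassoc [OF mult] mult merge)
      finally show "F \<bullet> Mult H \<bullet> (Mult H \<boxtimes> Id ?h) = F \<bullet> (Mult H \<bullet> (Id ?h \<boxtimes> Mult H)) \<bullet> \<alpha> ?h ?h ?h" .
    qed simp_all
    show "Mult H \<bullet> (Unit H \<boxtimes> Id ?h) = \<l> ?h"
    proof (rule cancel_F)
      have "F \<bullet> Mult H \<bullet> (Unit H \<boxtimes> Id ?h) = Mult A \<bullet> (Unit A \<boxtimes> Id ?a) \<bullet> (Id \<one> \<boxtimes> F)"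
        by (simp add: reassoc [OF mult] unit merge)
      also have "\<dots> = F \<bullet> \<l> ?h"
        by (simp add: reassoc [OF Mult_Unit_left [OF A]] \<l>_natural)
      finally show "F \<bullet> Mult H \<bullet> (Unit H \<boxtimes> Id ?h) = F \<bullet> \<l> ?h" .
    qed simp_all
    show "Mult H \<bullet> (Id ?h \<boxtimes> Unit H) = \<r> ?h"
    proof (rule cancel_F)
      have "F \<bullet> Mult H \<bullet> (Id ?h \<boxtimes> Unit H) = Mult A \<bullet> (Id ?a \<boxtimes> Unit A) \<bullet> (F \<boxtimes> Id \<one>)"
        by (simp add: reassoc [OF mult] unit merge)
      also have "\<dots> = F \<bullet> \<r> ?h"
        by (simp add: reassoc [OF Mult_Unit_right [OF A]] \<r>_natural)
      finally show "F \<bullet> Mult H \<bullet> (Id ?h \<boxtimes> Unit H) = F \<bullet> \<r> ?h" .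
    qed simp_all
  qed simp_all
  have coalgebra: "is_coalgebra M H"
    unfolding is_coalgebra_iff
  proof (intro conjI)
    let ?F3 = "F \<boxtimes> (F \<boxtimes> F)" and ?G3 = "G \<boxtimes> (G \<boxtimes> G)"
    show "(\<alpha> ?h ?h ?h \<bullet> (Comult H \<boxtimes> Id ?h)) \<bullet> Comult H = (Id ?h \<boxtimes> Comult H) \<bullet> Comult H"
    proof (rule cancel_mono [where G = ?F3 and K = ?G3])
      have "?F3 \<bullet> (\<alpha> ?h ?h ?h \<bullet> (Comult H \<boxtimes> Id ?h)) \<bullet> Comult H
          = \<alpha> ?a ?a ?a \<bullet> ((F \<boxtimes> F) \<boxtimes> F) \<bullet> (Comult H \<boxtimes> Id ?h) \<bullet> Comult H"
        by (simp add: reassoc [OF \<alpha>_natural])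
      also have "\<dots> = \<alpha> ?a ?a ?a \<bullet> (Comult A \<boxtimes> Id ?a) \<bullet> (F \<boxtimes> F) \<bullet> Comult H"
        by (simp add: merge comult)
      also have "\<dots> = (Id ?a \<boxtimes> Comult A) \<bullet> (F \<boxtimes> F) \<bullet> Comult H"
        by (simp add: reassoc3 [OF Comult_coassoc [OF A]] flip: comult)
      also have "\<dots> = ?F3 \<bullet> (Id ?h \<boxtimes> Comult H) \<bullet> Comult H"
        by (simp add: merge comult)
      finally show "?F3 \<bullet> (\<alpha> ?h ?h ?h \<bullet> (Comult H \<boxtimes> Id ?h)) \<bullet> Comult H
          = ?F3 \<bullet> (Id ?h \<boxtimes> Comult H) \<bullet> Comult H" .
    qed (simp_all add: interchange)
    show "(\<l> ?h \<bullet> (Counit H \<boxtimes> Id ?h)) \<bullet> Comult H = Id ?h"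
    proof (rule cancel_F)
      have "F \<bullet> (\<l> ?h \<bullet> (Counit H \<boxtimes> Id ?h)) \<bullet> Comult H
          = \<l> ?a \<bullet> (Id \<one> \<boxtimes> F) \<bullet> (Counit H \<boxtimes> Id ?h) \<bullet> Comult H"
        by (simp add: reassoc [OF \<l>_natural])
      also have "\<dots> = \<l> ?a \<bullet> (Counit A \<boxtimes> Id ?a) \<bullet> (F \<boxtimes> F) \<bullet> Comult H"
        by (simp add: merge counit)
      also have "\<dots> = \<l> ?a \<bullet> (Counit A \<boxtimes> Id ?a) \<bullet> Comult A \<bullet> F"
        by (simp add: comult)
      also have "\<dots> = F \<bullet> Id ?h"
        by (simp add: reassoc3 [OF Counit_left [OF A]])
      finally show "F \<bullet> (\<l> ?h \<bullet> (Counit H \<boxtimes> Id ?h)) \<bullet> Comult H = F \<bullet> Id ?h" .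
    qed simp_all
    show "(\<r> ?h \<bullet> (Id ?h \<boxtimes> Counit H)) \<bullet> Comult H = Id ?h"
    proof (rule cancel_F)
      have "F \<bullet> (\<r> ?h \<bullet> (Id ?h \<boxtimes> Counit H)) \<bullet> Comult H
          = \<r> ?a \<bullet> (F \<boxtimes> Id \<one>) \<bullet> (Id ?h \<boxtimes> Counit H) \<bullet> Comult H"
        by (simp add: reassoc [OF \<r>_natural])
      also have "\<dots> = \<r> ?a \<bullet> (Id ?a \<boxtimes> Counit A) \<bullet> (F \<boxtimes> F) \<bullet> Comult H"
        by (simp add: merge counit)
      also have "\<dots> = \<r> ?a \<bullet> (Id ?a \<boxtimes> Counit A) \<bullet> Comult A \<bullet> F"
        by (simp add: comult)
      also have "\<dots> = F \<bullet> Id ?h"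
        by (simp add: reassoc3 [OF Counit_right [OF A]])
      finally show "F \<bullet> (\<r> ?h \<bullet> (Id ?h \<boxtimes> Counit H)) \<bullet> Comult H = F \<bullet> Id ?h" .
    qed simp_all
  qed simp_all
  have "Comult H \<bullet> Mult H = (Mult H \<boxtimes> Mult H) \<bullet> \<tau> ?h ?h ?h ?h \<bullet> (Comult H \<boxtimes> Comult H)"
  proof (rule cancel_mono [where G = "F \<boxtimes> F" and K = "G \<boxtimes> G"])
    have "(F \<boxtimes> F) \<bullet> Comult H \<bullet> Mult H = Comult A \<bullet> Mult A \<bullet> (F \<boxtimes> F)"
      by (simp add: reassoc [OF comult [symmetric]] mult)
    also have "\<dots> = (Mult A \<boxtimes> Mult A) \<bullet> \<tau> ?a ?a ?a ?a \<bullet> ((F \<boxtimes> F) \<boxtimes> (F \<boxtimes> F)) \<bullet> (Comult H \<boxtimes> Comult H)"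
      by (simp add: reassoc [OF Comult_Mult [OF A]] merge comult)
    also have "\<dots> = (Mult A \<boxtimes> Mult A) \<bullet> ((F \<boxtimes> F) \<boxtimes> (F \<boxtimes> F)) \<bullet> \<tau> ?h ?h ?h ?h \<bullet> (Comult H \<boxtimes> Comult H)"
      by (simp add: reassoc [OF \<tau>_natural])
    also have "\<dots> = (F \<boxtimes> F) \<bullet> (Mult H \<boxtimes> Mult H) \<bullet> \<tau> ?h ?h ?h ?h \<bullet> (Comult H \<boxtimes> Comult H)"
      by (simp add: merge mult)
    finally show "(F \<boxtimes> F) \<bullet> Comult H \<bullet> Mult H
        = (F \<boxtimes> F) \<bullet> (Mult H \<boxtimes> Mult H) \<bullet> \<tau> ?h ?h ?h ?h \<bullet> (Comult H \<boxtimes> Comult H)" .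
  qed (simp_all add: interchange)
  moreover have "Counit H \<bullet> Mult H = \<l> \<one> \<bullet> (Counit H \<boxtimes> Counit H)"
    by (simp add: mult reassoc [OF Counit_Mult [OF A]] merge flip: counit)
  moreover have "Comult H \<bullet> Unit H = (Unit H \<boxtimes> Unit H) \<bullet> \<l>' \<one>"
  proof (rule cancel_mono [where G = "F \<boxtimes> F" and K = "G \<boxtimes> G"])
    show "(F \<boxtimes> F) \<bullet> Comult H \<bullet> Unit H = (F \<boxtimes> F) \<bullet> (Unit H \<boxtimes> Unit H) \<bullet> \<l>' \<one>"
      by (simp add: reassoc [OF comult [symmetric]] unit merge Comult_Unit [OF A])
  qed (simp_all add: interchange)
  moreover have "Counit H \<bullet> Unit H = Id \<one>"
    by (simp add: unit Counit_Unit [OF A] flip: counit)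
  ultimately show ?thesis
    using algebra coalgebra by (simp add: is_bialgebra_iff \<tau>_def)
qed

text \<open>
  Multiplicativity of \<open>\<Delta>\<close> on a product of two factors whose comultiplications restrict to \<open>D\<close> and
  \<open>E\<close>; it computes the coactions of products of elements of \<open>R\<close> and of \<open>B\<close>.
\<close>

lemma Comult_product:
  assumes H: "is_bialgebra M H"
    and [simp]: "arr F" "trg F = obj H" "arr D" "src D = src F" "trg D = src F \<odot> src F"
      "arr G" "trg G = obj H" "arr E" "src E = src G" "trg E = src G \<odot> src G"
    and F: "Comult H \<bullet> F = (F \<boxtimes> F) \<bullet> D"
    and G: "Comult H \<bullet> G = (G \<boxtimes> G) \<bullet> E"
  shows "Comult H \<bullet> Mult H \<bullet> (F \<boxtimes> G)
    = ((Mult H \<bullet> (F \<boxtimes> G)) \<boxtimes> (Mult H \<bullet> (F \<boxtimes> G))) \<bullet> \<tau> (src F) (src F) (src G) (src G) \<bullet> (D \<boxtimes> E)"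
proof -
  let ?h = "obj H"
  note [simp] = bialgebra_arr [OF H]
  have "Comult H \<bullet> Mult H \<bullet> (F \<boxtimes> G)
      = (Mult H \<boxtimes> Mult H) \<bullet> \<tau> ?h ?h ?h ?h \<bullet> ((F \<boxtimes> F) \<boxtimes> (G \<boxtimes> G)) \<bullet> (D \<boxtimes> E)"
    by (simp add: reassoc [OF Comult_Mult [OF H]] merge F G)
  also have "\<dots> = (Mult H \<boxtimes> Mult H) \<bullet> ((F \<boxtimes> G) \<boxtimes> (F \<boxtimes> G)) \<bullet> \<tau> (src F) (src F) (src G) (src G) \<bullet> (D \<boxtimes> E)"
    by (simp add: reassoc [OF \<tau>_natural])
  finally show ?thesis by (simp add: merge)
qed

end

section \<open>The decomposition of a bialgebra with a weak projection\<close>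

locale weak_projection = braided_monoidal_category M
  for M :: "('o, 'm) catdata" (structure) +
  fixes A B :: "('o, 'm) bialg" and R :: 'o and S \<sigma> \<pi> i p :: 'm
  assumes A: "is_bialgebra M A"
    and sub_bialgebra: "is_sub_bialgebra M A B \<sigma>"
    and antipode: "is_antipode M B S"
    and projection: "is_right_weak_projection M A B \<sigma> \<pi>"
    and coinvariants: "is_coinvariants M A B \<pi> R i"
    and p_in: "p \<in> Hom (obj A) R"
    and i_p: "i \<cdot> p = Pi2 M A \<sigma> S \<pi>"
    and p_i: "p \<cdot> i = \<langle>R\<rangle>"
begin

abbreviation "a \<equiv> obj A"
abbreviation "b \<equiv> obj B"
abbreviation "coinv \<equiv> coinvariant_data M A R i p"

definition s :: "('o, 'm) arrow" where "s = Arrow b \<sigma> a"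
definition q :: "('o, 'm) arrow" where "q = Arrow a \<pi> b"
definition T :: "('o, 'm) arrow" where "T = Arrow b S b"
definition j :: "('o, 'm) arrow" where "j = Arrow R i a"
definition P :: "('o, 'm) arrow" where "P = Arrow a p R"

lemmas wp_arrow_defs = s_def q_def T_def j_def P_def

lemma B: "is_bialgebra M B"
  using sub_bialgebra by (simp add: is_sub_bialgebra_def)

lemmas [simp] = bialgebra_arr [OF A] bialgebra_arr [OF B]

lemma src_trg_wp [simp]:
  "src s = b" "trg s = a" "src q = a" "trg q = b" "src T = b" "trg T = b"
  "src j = R" "trg j = a" "src P = a" "trg P = R"
  by (simp_all add: wp_arrow_defs)

lemma arr_wp [simp]: "arr s" "arr q" "arr T" "arr j" "arr P"
  using sub_bialgebra antipode projection coinvariants p_in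
  by (simp_all add: wp_arrow_defs arr_def is_sub_bialgebra_def is_bialgebra_hom_def
      is_algebra_hom_def is_antipode_def is_right_weak_projection_def is_coalgebra_hom_def
      is_coinvariants_def is_equalizer_def)

lemma obj_coinv [simp]: "obj coinv = R"
  by (simp add: coinvariant_data_def)

lemma s_hom:
  "s \<bullet> Mult B = Mult A \<bullet> (s \<boxtimes> s)" "s \<bullet> Unit B = Unit A"
  "Comult A \<bullet> s = (s \<boxtimes> s) \<bullet> Comult B" "Counit A \<bullet> s = Counit B"
  using sub_bialgebra
  by (simp_all add: wp_arrow_defs bialg_arrow_defs arrow_defs is_sub_bialgebra_def
      is_bialgebra_hom_def is_algebra_hom_def is_coalgebra_hom_def)

lemma q_hom: "Comult B \<bullet> q = (q \<boxtimes> q) \<bullet> Comult A" "Counit B \<bullet> q = Counit A"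
  using projection
  by (simp_all add: wp_arrow_defs bialg_arrow_defs arrow_defs is_right_weak_projection_def
      is_coalgebra_hom_def)

lemma q_s [simp]: "q \<bullet> s = Id b"
  using projection by (simp add: wp_arrow_defs arrow_defs is_right_weak_projection_def)

lemma q_linear: "q \<bullet> Mult A \<bullet> (Id a \<boxtimes> s) = Mult B \<bullet> (q \<boxtimes> Id b)"
proof -
  have "(q \<bullet> Mult A) \<bullet> (Id a \<boxtimes> s) = Mult B \<bullet> (q \<boxtimes> Id b)"
    using projection
    by (simp add: wp_arrow_defs bialg_arrow_defs arrow_defs is_right_weak_projection_def)
  then show ?thesis by simp
qed

lemma T_antipode:
  "Mult B \<bullet> (T \<boxtimes> Id b) \<bullet> Comult B = Unit B \<bullet> Counit B"
  "Mult B \<bullet> (Id b \<boxtimes> T) \<bullet> Comult B = Unit B \<bullet> Counit B"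
proof -
  have "(Mult B \<bullet> (T \<boxtimes> Id b)) \<bullet> Comult B = Unit B \<bullet> Counit B"
    "(Mult B \<bullet> (Id b \<boxtimes> T)) \<bullet> Comult B = Unit B \<bullet> Counit B"
    using antipode by (simp_all add: wp_arrow_defs bialg_arrow_defs arrow_defs is_antipode_def)
  then show "Mult B \<bullet> (T \<boxtimes> Id b) \<bullet> Comult B = Unit B \<bullet> Counit B"
    "Mult B \<bullet> (Id b \<boxtimes> T) \<bullet> Comult B = Unit B \<bullet> Counit B"
    by simp_all
qed

lemma P_j [simp]: "P \<bullet> j = Id R"
  using p_i by (simp add: wp_arrow_defs arrow_defs)

lemma j_P: "j \<bullet> P = Mult A \<bullet> (Id a \<boxtimes> (s \<bullet> T \<bullet> q)) \<bullet> Comult A"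
proof -
  have "j \<bullet> P = (Mult A \<bullet> (Id a \<boxtimes> ((s \<bullet> T) \<bullet> q))) \<bullet> Comult A"
    using i_p by (simp add: wp_arrow_defs bialg_arrow_defs arrow_defs Pi2_def Phi_def)
  then show ?thesis by simp
qed

lemma coinvariance: "(Id a \<boxtimes> q) \<bullet> Comult A \<bullet> j = (j \<boxtimes> Unit B) \<bullet> \<r>' R"
proof -
  have "((Id a \<boxtimes> q) \<bullet> Comult A) \<bullet> j = ((Id a \<boxtimes> Unit B) \<bullet> \<r>' a) \<bullet> j"
    using coinvariants
    by (simp add: wp_arrow_defs bialg_arrow_defs arrow_defs is_coinvariants_def is_equalizer_def)
  then show ?thesis
    using \<r>'_natural [of j] by (simp add: merge)
qed

text \<open>
  The antipode axiom evaluated at the unit of \<open>B\<close> reads \<open>1 S(1) = 1\<close>.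
\<close>

lemma T_Unit: "T \<bullet> Unit B = Unit B"
proof -
  have "Mult B \<bullet> (Id b \<boxtimes> T) \<bullet> Comult B \<bullet> Unit B
      = Mult B \<bullet> (Unit B \<boxtimes> Id b) \<bullet> (Id \<one> \<boxtimes> (T \<bullet> Unit B)) \<bullet> \<l>' \<one>"
    by (simp add: merge Comult_Unit [OF B])
  also have "\<dots> = T \<bullet> Unit B"
    by (simp add: reassoc [OF Mult_Unit_left [OF B]] reassoc [OF \<l>_natural])
  finally have "T \<bullet> Unit B = Unit B \<bullet> Counit B \<bullet> Unit B"
    by (simp add: reassoc3 [OF T_antipode(2)])
  then show ?thesis by (simp add: Counit_Unit [OF B])
qed

lemma sT_Unit: "s \<bullet> T \<bullet> Unit B = Unit A"
  by (simp add: T_Unit s_hom)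

lemma s_antipode:
  "Mult A \<bullet> (s \<boxtimes> (s \<bullet> T)) \<bullet> Comult B = Unit A \<bullet> Counit B"
  "Mult A \<bullet> ((s \<bullet> T) \<boxtimes> s) \<bullet> Comult B = Unit A \<bullet> Counit B"
proof -
  have "Mult A \<bullet> (s \<boxtimes> (s \<bullet> T)) \<bullet> Comult B = s \<bullet> Mult B \<bullet> (Id b \<boxtimes> T) \<bullet> Comult B"
    by (simp add: reassoc [OF s_hom(1)] merge)
  then show "Mult A \<bullet> (s \<boxtimes> (s \<bullet> T)) \<bullet> Comult B = Unit A \<bullet> Counit B"
    by (simp add: T_antipode reassoc [OF s_hom(2)])
  have "Mult A \<bullet> ((s \<bullet> T) \<boxtimes> s) \<bullet> Comult B = s \<bullet> Mult B \<bullet> (T \<boxtimes> Id b) \<bullet> Comult B"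
    by (simp add: reassoc [OF s_hom(1)] merge)
  then show "Mult A \<bullet> ((s \<bullet> T) \<boxtimes> s) \<bullet> Comult B = Unit A \<bullet> Counit B"
    by (simp add: T_antipode reassoc [OF s_hom(2)])
qed

definition \<phi> :: "('o, 'm) arrow" where "\<phi> = Mult A \<bullet> (j \<boxtimes> s)"
definition \<psi> :: "('o, 'm) arrow" where "\<psi> = (P \<boxtimes> q) \<bullet> Comult A"

lemma \<phi>_\<psi>_simps [simp]:
  "arr \<phi>" "src \<phi> = R \<odot> b" "trg \<phi> = a" "arr \<psi>" "src \<psi> = a" "trg \<psi> = R \<odot> b"
  by (simp_all add: \<phi>_def \<psi>_def)

text \<open>
  In elements: \<open>(r b)\<^sub>1 \<otimes> \<pi>((r b)\<^sub>2) = r\<^sub>1 b\<^sub>1 \<otimes> \<pi>(r\<^sub>2) b\<^sub>2\<close> by right linearity of \<open>\<pi>\<close>, and coinvariance of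
  \<open>r\<close> replaces \<open>r\<^sub>1 \<otimes> \<pi>(r\<^sub>2)\<close> by \<open>r \<otimes> 1\<close>. By naturality \<open>\<pi>\<close> is applied to \<open>r\<^sub>2\<close> before the braiding,
  so that the braiding of \<open>r\<^sub>2\<close> with \<open>b\<^sub>1\<close> becomes one with the unit object.
\<close>

lemma coaction_\<phi>:
  "(Id a \<boxtimes> q) \<bullet> Comult A \<bullet> \<phi> = (\<phi> \<boxtimes> Id b) \<bullet> \<alpha>' R b b \<bullet> (Id R \<boxtimes> Comult B)"
proof -
  have "(Id a \<boxtimes> q) \<bullet> Comult A \<bullet> \<phi>
      = (Mult A \<boxtimes> (q \<bullet> Mult A)) \<bullet> \<tau> a a a a \<bullet> ((Id a \<boxtimes> Id a) \<boxtimes> (s \<boxtimes> s)) \<bullet> ((Comult A \<bullet> j) \<boxtimes> Comult B)"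
    by (simp add: \<phi>_def reassoc [OF Comult_Mult [OF A]] merge s_hom)
  also have "\<dots> = (Mult A \<boxtimes> (q \<bullet> Mult A)) \<bullet> ((Id a \<boxtimes> s) \<boxtimes> (Id a \<boxtimes> s)) \<bullet> \<tau> a a b b
      \<bullet> ((Comult A \<bullet> j) \<boxtimes> Comult B)"
    by (simp add: reassoc [OF \<tau>_natural] del: Id_tensor)
  also have "\<dots> = ((Mult A \<bullet> (Id a \<boxtimes> s)) \<boxtimes> Mult B) \<bullet> ((Id a \<boxtimes> Id b) \<boxtimes> (q \<boxtimes> Id b)) \<bullet> \<tau> a a b b
      \<bullet> ((Comult A \<bullet> j) \<boxtimes> Comult B)"
    by (simp add: merge q_linear)
  also have "\<dots> = ((Mult A \<bullet> (Id a \<boxtimes> s)) \<boxtimes> Mult B) \<bullet> \<tau> a b b b \<bullet> ((Id a \<boxtimes> q) \<boxtimes> (Id b \<boxtimes> Id b))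
      \<bullet> ((Comult A \<bullet> j) \<boxtimes> Comult B)"
    by (simp add: reassoc [OF \<tau>_natural] del: Id_tensor)
  also have "\<dots> = ((Mult A \<bullet> (Id a \<boxtimes> s)) \<boxtimes> Mult B) \<bullet> \<tau> a b b b \<bullet> ((j \<boxtimes> Unit B) \<boxtimes> (Id b \<boxtimes> Id b))
      \<bullet> (\<r>' R \<boxtimes> Comult B)"
    by (simp add: merge coinvariance)
  also have "\<dots> = ((Mult A \<bullet> (Id a \<boxtimes> s)) \<boxtimes> Mult B) \<bullet> ((j \<boxtimes> Id b) \<boxtimes> (Unit B \<boxtimes> Id b)) \<bullet> \<tau> R \<one> b b
      \<bullet> (\<r>' R \<boxtimes> Comult B)"
    by (simp add: reassoc [OF \<tau>_natural] del: Id_tensor)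
  also have "\<dots> = (\<phi> \<boxtimes> Id b) \<bullet> (Id (R \<odot> b) \<boxtimes> \<l> b) \<bullet> \<tau> R \<one> b b \<bullet> (\<r>' R \<boxtimes> Comult B)"
    by (simp add: merge Mult_Unit_left [OF B] \<phi>_def)
  also have "\<dots> = (\<phi> \<boxtimes> Id b) \<bullet> \<alpha>' R b b \<bullet> (Id R \<boxtimes> Comult B)"
    by (simp add: reassoc [OF \<tau>_one_second] merge)
  finally show ?thesis .
qed

lemma j_P_coaction: "j \<bullet> P = Mult A \<bullet> (Id a \<boxtimes> (s \<bullet> T)) \<bullet> (Id a \<boxtimes> q) \<bullet> Comult A"
  by (simp add: j_P merge)

text \<open>
  By the coaction formula \<open>i p(r b) = r b\<^sub>1 S(b\<^sub>2) = r \<epsilon>(b)\<close>; the map \<open>i\<close> is split by \<open>p\<close>.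
\<close>

lemma P_\<phi>: "P \<bullet> \<phi> = \<r> R \<bullet> (Id R \<boxtimes> Counit B)"
proof (rule cancel_mono [where G = j and K = P])
  have "j \<bullet> P \<bullet> \<phi> = (j \<bullet> P) \<bullet> \<phi>"
    by simp
  also have "\<dots> = Mult A \<bullet> (Id a \<boxtimes> (s \<bullet> T)) \<bullet> (Id a \<boxtimes> q) \<bullet> Comult A \<bullet> \<phi>"
    by (simp only: j_P_coaction) simp
  also have "\<dots> = Mult A \<bullet> (\<phi> \<boxtimes> (s \<bullet> T)) \<bullet> \<alpha>' R b b \<bullet> (Id R \<boxtimes> Comult B)"
    by (simp add: coaction_\<phi>) (simp add: merge)
  also have "\<dots> = Mult A \<bullet> (j \<boxtimes> (Mult A \<bullet> (s \<boxtimes> (s \<bullet> T)) \<bullet> Comult B))"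
    by (simp add: \<phi>_def reassoc [OF Mult_assoc_arrows [OF A]] merge)
  also have "\<dots> = Mult A \<bullet> (j \<boxtimes> Unit A) \<bullet> (Id R \<boxtimes> Counit B)"
    by (simp add: s_antipode merge)
  also have "\<dots> = j \<bullet> \<r> R \<bullet> (Id R \<boxtimes> Counit B)"
    by (simp add: reassoc [OF Mult_Unit_arrow [OF A]])
  finally show "j \<bullet> P \<bullet> \<phi> = j \<bullet> \<r> R \<bullet> (Id R \<boxtimes> Counit B)" .
qed simp_all

text \<open>
  By the coaction formula \<open>\<psi>(r b) = p(r b\<^sub>1) \<otimes> b\<^sub>2\<close>, to which the previous lemma applies.
\<close>

lemma \<psi>_\<phi>: "\<psi> \<bullet> \<phi> = Id (R \<odot> b)"
proof -
  have "\<psi> \<bullet> \<phi> = (P \<boxtimes> Id b) \<bullet> (Id a \<boxtimes> q) \<bullet> Comult A \<bullet> \<phi>"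
    by (simp add: \<psi>_def merge)
  also have "\<dots> = (\<r> R \<boxtimes> Id b) \<bullet> ((Id R \<boxtimes> Counit B) \<boxtimes> Id b) \<bullet> \<alpha>' R b b \<bullet> (Id R \<boxtimes> Comult B)"
    by (simp add: coaction_\<phi>) (simp add: merge P_\<phi>)
  also have "\<dots> = (\<r> R \<boxtimes> Id b) \<bullet> \<alpha>' R \<one> b \<bullet> (Id R \<boxtimes> (Counit B \<boxtimes> Id b)) \<bullet> (Id R \<boxtimes> Comult B)"
    by (simp add: reassoc [OF \<alpha>'_natural])
  also have "\<dots> = Id (R \<odot> b)"
    by (simp add: reassoc [OF triangle_arrow'] merge Counit_left [OF B])
  finally show ?thesis .
qed

text \<open>
  In elements: \<open>a\<^sub>1 S(\<pi>(a\<^sub>2)) \<pi>(a\<^sub>3) = a\<close>, because \<open>\<pi>\<close> is comultiplicative and \<open>S\<close> is an antipode.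
\<close>

lemma \<phi>_\<psi>: "\<phi> \<bullet> \<psi> = Id a"
proof -
  have "\<phi> \<bullet> \<psi> = Mult A \<bullet> ((Mult A \<bullet> (Id a \<boxtimes> (s \<bullet> T \<bullet> q)) \<bullet> Comult A) \<boxtimes> (s \<bullet> q)) \<bullet> Comult A"
    by (simp add: \<phi>_def \<psi>_def merge j_P)
  also have "\<dots> = Mult A \<bullet> ((Mult A \<bullet> (Id a \<boxtimes> (s \<bullet> T \<bullet> q))) \<boxtimes> (s \<bullet> q)) \<bullet> (Comult A \<boxtimes> Id a) \<bullet> Comult A"
    by (simp add: merge)
  also have "\<dots> = Mult A \<bullet> (Id a \<boxtimes> (Mult A \<bullet> ((s \<bullet> T \<bullet> q) \<boxtimes> (s \<bullet> q)))) \<bullet> (Id a \<boxtimes> Comult A) \<bullet> Comult A"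
    by (simp add: reassoc [OF Mult_assoc_arrows [OF A]] Comult_coassoc [OF A])
  also have "\<dots> = Mult A \<bullet> (Id a \<boxtimes> (Mult A \<bullet> ((s \<bullet> T) \<boxtimes> s) \<bullet> (q \<boxtimes> q) \<bullet> Comult A)) \<bullet> Comult A"
    by (simp add: merge)
  also have "(q \<boxtimes> q) \<bullet> Comult A = Comult B \<bullet> q"
    by (simp add: q_hom)
  also have "Mult A \<bullet> (Id a \<boxtimes> (Mult A \<bullet> ((s \<bullet> T) \<boxtimes> s) \<bullet> Comult B \<bullet> q)) \<bullet> Comult A
      = Mult A \<bullet> (Id a \<boxtimes> Unit A) \<bullet> (Id a \<boxtimes> Counit A) \<bullet> Comult A"
    by (simp add: reassoc3 [OF s_antipode(2)] q_hom(2) merge)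
  also have "\<dots> = Id a"
    by (simp add: reassoc [OF Mult_Unit_right [OF A]] Counit_right [OF A])
  finally show ?thesis .
qed

lemma Mult_\<phi>: "Mult A \<bullet> (\<phi> \<boxtimes> s) = \<phi> \<bullet> (Id R \<boxtimes> Mult B) \<bullet> \<alpha> R b b"
proof -
  have "Mult A \<bullet> (\<phi> \<boxtimes> s) = Mult A \<bullet> (j \<boxtimes> (s \<bullet> Mult B)) \<bullet> \<alpha> R b b"
    by (simp add: \<phi>_def Mult_assoc_arrows [OF A] s_hom)
  then show ?thesis by (simp add: \<phi>_def merge)
qed

text \<open>
  It suffices to test on \<open>a = r b'\<close>, where \<open>p(r b' b) = r \<epsilon>(b' b) = r \<epsilon>(b') \<epsilon>(b)\<close>.
\<close>

lemma P_right: "P \<bullet> Mult A \<bullet> (Id a \<boxtimes> s) = \<r> R \<bullet> (P \<boxtimes> Counit B)"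
proof (rule cancel_epi [where G = "\<phi> \<boxtimes> Id b" and K = "\<psi> \<boxtimes> Id b"])
  have "(P \<bullet> Mult A \<bullet> (Id a \<boxtimes> s)) \<bullet> (\<phi> \<boxtimes> Id b) = P \<bullet> \<phi> \<bullet> (Id R \<boxtimes> Mult B) \<bullet> \<alpha> R b b"
    by (simp add: merge Mult_\<phi>)
  also have "\<dots> = \<r> R \<bullet> (Id R \<boxtimes> \<l> \<one>) \<bullet> (Id R \<boxtimes> (Counit B \<boxtimes> Counit B)) \<bullet> \<alpha> R b b"
    by (simp add: reassoc [OF P_\<phi>] merge Counit_Mult [OF B])
  also have "\<dots> = \<r> R \<bullet> (Id R \<boxtimes> \<l> \<one>) \<bullet> \<alpha> R \<one> \<one> \<bullet> ((Id R \<boxtimes> Counit B) \<boxtimes> Counit B)"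
    by (simp add: \<alpha>_natural)
  also have "\<dots> = \<r> R \<bullet> ((P \<bullet> \<phi>) \<boxtimes> Counit B)"
    by (simp add: reassoc [OF triangle_arrow] P_\<phi> merge)
  also have "\<dots> = (\<r> R \<bullet> (P \<boxtimes> Counit B)) \<bullet> (\<phi> \<boxtimes> Id b)"
    by (simp add: merge)
  finally show "(P \<bullet> Mult A \<bullet> (Id a \<boxtimes> s)) \<bullet> (\<phi> \<boxtimes> Id b) = (\<r> R \<bullet> (P \<boxtimes> Counit B)) \<bullet> (\<phi> \<boxtimes> Id b)" .
qed (simp_all add: merge \<phi>_\<psi>)

definition act :: "('o, 'm) arrow" where "act = P \<bullet> Mult A \<bullet> (s \<boxtimes> j)"

lemma act_simps [simp]: "arr act" "src act = b \<odot> R" "trg act = R"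
  by (simp_all add: act_def)

lemma Mult_\<phi>_left: "Mult A \<bullet> (s \<boxtimes> \<phi>) = Mult A \<bullet> ((Mult A \<bullet> (s \<boxtimes> j)) \<boxtimes> s) \<bullet> \<alpha>' b R b"
  by (simp add: \<phi>_def reassoc [OF Mult_assoc_arrows [OF A]])

text \<open>
  For \<open>a = r b'\<close> the rule \<open>P_right\<close> gives
  \<open>p(b (r b')) = p((b r) b') = p(b r) \<epsilon>(b') = b \<rhd> (r \<epsilon>(b')) = b \<rhd> p(r b')\<close>. It yields associativity of
  the action at once, since \<open>b \<rhd> (b' \<rhd> r) = b \<rhd> p(b' r) = p(b b' r)\<close>.
\<close>

lemma P_left: "P \<bullet> Mult A \<bullet> (s \<boxtimes> Id a) = act \<bullet> (Id b \<boxtimes> P)"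
proof (rule cancel_epi [where G = "Id b \<boxtimes> \<phi>" and K = "Id b \<boxtimes> \<psi>"])
  have "(P \<bullet> Mult A \<bullet> (s \<boxtimes> Id a)) \<bullet> (Id b \<boxtimes> \<phi>)
      = (P \<bullet> Mult A \<bullet> (Id a \<boxtimes> s)) \<bullet> ((Mult A \<bullet> (s \<boxtimes> j)) \<boxtimes> Id b) \<bullet> \<alpha>' b R b"
    by (simp add: merge Mult_\<phi>_left)
  also have "\<dots> = \<r> R \<bullet> (act \<boxtimes> Id \<one>) \<bullet> ((Id b \<boxtimes> Id R) \<boxtimes> Counit B) \<bullet> \<alpha>' b R b"
    by (simp only: P_right) (simp add: merge act_def)
  also have "\<dots> = act \<bullet> \<r> (b \<odot> R) \<bullet> \<alpha>' b R \<one> \<bullet> (Id b \<boxtimes> (Id R \<boxtimes> Counit B))"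
    by (simp add: reassoc [OF \<r>_natural] \<alpha>'_natural del: Id_tensor)
  also have "\<dots> = (act \<bullet> (Id b \<boxtimes> P)) \<bullet> (Id b \<boxtimes> \<phi>)"
    by (simp add: reassoc [OF \<r>_tensor']) (simp add: merge P_\<phi>)
  finally show "(P \<bullet> Mult A \<bullet> (s \<boxtimes> Id a)) \<bullet> (Id b \<boxtimes> \<phi>) = (act \<bullet> (Id b \<boxtimes> P)) \<bullet> (Id b \<boxtimes> \<phi>)" .
qed (simp_all add: merge \<phi>_\<psi>)

lemma act_Mult: "act \<bullet> (Mult B \<boxtimes> Id R) = act \<bullet> (Id b \<boxtimes> act) \<bullet> \<alpha> b b R"
proof -
  have "act \<bullet> (Mult B \<boxtimes> Id R) = P \<bullet> Mult A \<bullet> ((Mult A \<bullet> (s \<boxtimes> s)) \<boxtimes> j)"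
    by (simp add: act_def merge s_hom)
  also have "\<dots> = (P \<bullet> Mult A \<bullet> (s \<boxtimes> Id a)) \<bullet> (Id b \<boxtimes> (Mult A \<bullet> (s \<boxtimes> j))) \<bullet> \<alpha> b b R"
    by (simp add: Mult_assoc_arrows [OF A] merge)
  also have "\<dots> = act \<bullet> (Id b \<boxtimes> act) \<bullet> \<alpha> b b R"
    by (simp only: P_left) (simp add: merge act_def)
  finally show ?thesis .
qed

lemma act_Unit: "act \<bullet> (Unit B \<boxtimes> Id R) = \<l> R"
proof -
  have "act \<bullet> (Unit B \<boxtimes> Id R) = P \<bullet> Mult A \<bullet> (Unit A \<boxtimes> Id a) \<bullet> (Id \<one> \<boxtimes> j)"
    by (simp add: act_def merge s_hom)
  then show ?thesis
    by (simp add: reassoc [OF Mult_Unit_left [OF A]] \<l>_natural reassoc [OF P_j])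
qed

lemma j_P_Unit: "j \<bullet> P \<bullet> Unit A = Unit A"
proof -
  have "q \<bullet> Unit A = Unit B"
    using reassoc [OF q_s, of "Unit B"] by (simp add: s_hom)
  then have "(j \<bullet> P) \<bullet> Unit A = Mult A \<bullet> (Unit A \<boxtimes> Unit A) \<bullet> \<l>' \<one>"
    by (simp add: j_P Comult_Unit [OF A] merge sT_Unit)
  also have "\<dots> = Mult A \<bullet> (Unit A \<boxtimes> Id a) \<bullet> (Id \<one> \<boxtimes> Unit A) \<bullet> \<l>' \<one>"
    by (simp add: merge)
  also have "\<dots> = Unit A"
    by (simp add: reassoc [OF Mult_Unit_left [OF A]] reassoc [OF \<l>_natural])
  finally show ?thesis by simp
qed

lemma coinv_arrows:
  "Mult coinv = P \<bullet> Mult A \<bullet> (j \<boxtimes> j)" "Unit coinv = P \<bullet> Unit A"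
  "Comult coinv = (P \<boxtimes> P) \<bullet> Comult A \<bullet> j" "Counit coinv = Counit A \<bullet> j"
proof -
  have "Mult coinv = (P \<bullet> Mult A) \<bullet> (j \<boxtimes> j)" "Comult coinv = ((P \<boxtimes> P) \<bullet> Comult A) \<bullet> j"
    by (simp_all add: coinvariant_data_def bialg_arrow_defs wp_arrow_defs arrow_defs)
  then show "Mult coinv = P \<bullet> Mult A \<bullet> (j \<boxtimes> j)" "Comult coinv = (P \<boxtimes> P) \<bullet> Comult A \<bullet> j"
    by simp_all
  show "Unit coinv = P \<bullet> Unit A" "Counit coinv = Counit A \<bullet> j"
    by (simp_all add: coinvariant_data_def bialg_arrow_defs wp_arrow_defs arrow_defs)
qed

lemma arr_coinv [simp]: "arr (Mult coinv)" "arr (Unit coinv)" "arr (Comult coinv)" "arr (Counit coinv)"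
  by (simp_all add: coinv_arrows)

lemma j_Unit: "j \<bullet> Unit coinv = Unit A"
  by (simp add: coinv_arrows j_P_Unit)

text \<open>
  Applying the counit of \<open>A\<close> to the first factor of the coaction \<open>r \<mapsto> r \<otimes> 1\<close> gives \<open>\<pi>(r) = \<epsilon>(r) 1\<close>.
  The two unit constraints on \<open>\<one>\<close> that appear on either side agree by \<open>\<l>_one\<close>.
\<close>

lemma q_j: "q \<bullet> j = Unit B \<bullet> Counit coinv"
proof -
  have "q \<bullet> j = q \<bullet> \<l> a \<bullet> (Counit A \<boxtimes> Id a) \<bullet> Comult A \<bullet> j"
    by (simp add: reassoc3 [OF Counit_left [OF A]])
  also have "\<dots> = \<l> b \<bullet> (Id \<one> \<boxtimes> q) \<bullet> (Counit A \<boxtimes> Id a) \<bullet> Comult A \<bullet> j"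
    by (simp add: reassoc [OF \<l>_natural])
  also have "\<dots> = \<l> b \<bullet> (Counit A \<boxtimes> Id b) \<bullet> (Id a \<boxtimes> q) \<bullet> Comult A \<bullet> j"
    by (simp add: merge)
  also have "\<dots> = \<l> b \<bullet> (Id \<one> \<boxtimes> Unit B) \<bullet> (Counit coinv \<boxtimes> Id \<one>) \<bullet> \<r>' R"
    by (simp add: coinvariance) (simp add: merge coinv_arrows)
  also have "\<dots> = Unit B \<bullet> \<r> \<one> \<bullet> (Counit coinv \<boxtimes> Id \<one>) \<bullet> \<r>' R"
    by (simp add: reassoc [OF \<l>_natural] \<l>_one)
  also have "\<dots> = Unit B \<bullet> Counit coinv"
    by (simp add: reassoc [OF \<r>_natural])
  finally show ?thesis .
qed

end

section \<open>Cocommutativity and the trivial right action\<close>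

locale cocommutative_weak_projection = weak_projection M A B R S \<sigma> \<pi> i p
  for M :: "('o, 'm) catdata" (structure) and A B :: "('o, 'm) bialg" and R :: 'o
    and S \<sigma> \<pi> i p :: 'm +
  assumes cocommutative: "is_cocommutative M A"
begin

lemma Comult_cocomm: "\<gamma> a a \<bullet> Comult A = Comult A"
  using cocommutative by (simp add: is_cocommutative_def bialg_arrow_defs arrow_defs)

text \<open>
  For \<open>r\<close> in \<open>R\<close> this is \<open>r\<^sub>1 \<otimes> r\<^sub>2 S(\<pi>(r\<^sub>3)) = r\<^sub>1 \<otimes> r\<^sub>2\<close>: by coassociativity the coaction is applied to
  \<open>r\<close> itself, where it is trivial.
\<close>

lemma Comult_j_right: "(Id a \<boxtimes> (j \<bullet> P)) \<bullet> Comult A \<bullet> j = Comult A \<bullet> j"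
proof -
  have "(Id a \<boxtimes> (j \<bullet> P)) \<bullet> Comult A \<bullet> j
      = (Id a \<boxtimes> (Mult A \<bullet> (Id a \<boxtimes> (s \<bullet> T \<bullet> q)))) \<bullet> (Id a \<boxtimes> Comult A) \<bullet> Comult A \<bullet> j"
    by (simp add: j_P merge)
  also have "\<dots> = (Id a \<boxtimes> (Mult A \<bullet> (Id a \<boxtimes> (s \<bullet> T \<bullet> q)))) \<bullet> \<alpha> a a a \<bullet> (Comult A \<boxtimes> Id a) \<bullet> Comult A \<bullet> j"
    by (simp add: reassoc3 [OF Comult_coassoc [OF A]])
  also have "\<dots> = (Id a \<boxtimes> Mult A) \<bullet> (Id a \<boxtimes> (Id a \<boxtimes> (s \<bullet> T \<bullet> q))) \<bullet> \<alpha> a a a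
      \<bullet> (Comult A \<boxtimes> Id a) \<bullet> Comult A \<bullet> j"
    by (simp add: merge)
  also have "\<dots> = (Id a \<boxtimes> Mult A) \<bullet> \<alpha> a a a \<bullet> ((Id a \<boxtimes> Id a) \<boxtimes> (s \<bullet> T \<bullet> q))
      \<bullet> (Comult A \<boxtimes> Id a) \<bullet> Comult A \<bullet> j"
    by (simp add: reassoc [OF \<alpha>_natural] del: Id_tensor)
  also have "\<dots> = (Id a \<boxtimes> Mult A) \<bullet> \<alpha> a a a \<bullet> (Comult A \<boxtimes> (s \<bullet> T)) \<bullet> (Id a \<boxtimes> q) \<bullet> Comult A \<bullet> j"
    by (simp add: merge)
  also have "\<dots> = (Id a \<boxtimes> Mult A) \<bullet> \<alpha> a a a \<bullet> ((Id a \<boxtimes> Id a) \<boxtimes> Unit A) \<bullet> ((Comult A \<bullet> j) \<boxtimes> Id \<one>) \<bullet> \<r>' R"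
    by (simp add: coinvariance) (simp add: merge sT_Unit)
  also have "\<dots> = (Id a \<boxtimes> Mult A) \<bullet> (Id a \<boxtimes> (Id a \<boxtimes> Unit A)) \<bullet> \<alpha> a a \<one> \<bullet> ((Comult A \<bullet> j) \<boxtimes> Id \<one>) \<bullet> \<r>' R"
    by (simp add: reassoc [OF \<alpha>_natural] del: Id_tensor)
  also have "\<dots> = (Id a \<boxtimes> \<r> a) \<bullet> \<alpha> a a \<one> \<bullet> ((Comult A \<bullet> j) \<boxtimes> Id \<one>) \<bullet> \<r>' R"
    by (simp add: merge Mult_Unit_right [OF A])
  also have "\<dots> = Comult A \<bullet> j"
    by (simp add: reassoc [OF \<r>_tensor] reassoc [OF \<r>_natural])
  finally show ?thesis .
qed

text \<open>
  The previous lemma puts the second factor of \<open>\<Delta>(r)\<close> into \<open>R\<close>, and cocommutativity transfers this to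
  the first factor.
\<close>

lemma j_Comult: "Comult A \<bullet> j = (j \<boxtimes> j) \<bullet> Comult coinv"
proof -
  have left: "((j \<bullet> P) \<boxtimes> Id a) \<bullet> Comult A \<bullet> j = Comult A \<bullet> j"
  proof (rule cancel_mono [where G = "\<gamma> a a" and K = "\<gamma>' a a"])
    have "\<gamma> a a \<bullet> ((j \<bullet> P) \<boxtimes> Id a) \<bullet> Comult A \<bullet> j = (Id a \<boxtimes> (j \<bullet> P)) \<bullet> \<gamma> a a \<bullet> Comult A \<bullet> j"
      by (simp add: reassoc [OF \<gamma>_natural])
    then show "\<gamma> a a \<bullet> ((j \<bullet> P) \<boxtimes> Id a) \<bullet> Comult A \<bullet> j = \<gamma> a a \<bullet> Comult A \<bullet> j"
      by (simp add: reassoc [OF Comult_cocomm] Comult_j_right)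
  qed simp_all
  have "(j \<boxtimes> j) \<bullet> Comult coinv = ((j \<bullet> P) \<boxtimes> Id a) \<bullet> (Id a \<boxtimes> (j \<bullet> P)) \<bullet> Comult A \<bullet> j"
    by (simp add: coinv_arrows merge)
  then show ?thesis
    by (simp only: Comult_j_right left)
qed

lemma Counit_coinv_right: "(Id R \<boxtimes> Counit coinv) \<bullet> Comult coinv = \<r>' R"
proof -
  have "\<r> R \<bullet> (Id R \<boxtimes> Counit coinv) \<bullet> Comult coinv = Id R"
  proof (rule cancel_mono [where G = j and K = P])
    have "j \<bullet> \<r> R \<bullet> (Id R \<boxtimes> Counit coinv) \<bullet> Comult coinv
        = \<r> a \<bullet> (j \<boxtimes> Id \<one>) \<bullet> (Id R \<boxtimes> Counit coinv) \<bullet> Comult coinv"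
      by (simp add: reassoc [OF \<r>_natural])
    also have "\<dots> = \<r> a \<bullet> (Id a \<boxtimes> Counit A) \<bullet> Comult A \<bullet> j"
      by (simp add: j_Comult) (simp add: merge coinv_arrows(4))
    also have "\<dots> = j \<bullet> Id R"
      by (simp add: reassoc3 [OF Counit_right [OF A]])
    finally show "j \<bullet> \<r> R \<bullet> (Id R \<boxtimes> Counit coinv) \<bullet> Comult coinv = j \<bullet> Id R" .
  qed simp_all
  then have "\<r> R \<bullet> (Id R \<boxtimes> Counit coinv) \<bullet> Comult coinv = \<r> R \<bullet> \<r>' R"
    by simp
  then show ?thesis
    by (rule cancel_mono [where G = "\<r> R" and K = "\<r>' R"]) simp_all
qed

lemma \<phi>_Comult: "Comult A \<bullet> \<phi> = (\<phi> \<boxtimes> \<phi>) \<bullet> \<tau> R R b b \<bullet> (Comult coinv \<boxtimes> Comult B)"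
  using Comult_product [OF A, where F = j and D = "Comult coinv" and G = s and E = "Comult B"]
  by (simp add: \<phi>_def j_Comult s_hom)

abbreviation "ract_trivial \<equiv> right_act_trivial M coinv B (right_act M A \<sigma> \<pi> i)"

lemma ract_trivial_arrow:
  "ract_trivial \<longleftrightarrow> q \<bullet> Mult A \<bullet> (s \<boxtimes> j) = \<r> b \<bullet> (Id b \<boxtimes> Counit coinv)"
proof -
  have "ract_trivial \<longleftrightarrow> (q \<bullet> Mult A) \<bullet> (s \<boxtimes> j) = \<r> b \<bullet> (Id b \<boxtimes> Counit coinv)"
    by (simp add: right_act_trivial_def right_act_def coinvariant_data_def bialg_arrow_defs
        wp_arrow_defs arrow_defs)
  then show ?thesis by simp
qed

text \<open>
  The map \<open>b \<otimes> r \<mapsto> b\<^sub>1 \<otimes> r \<otimes> b\<^sub>2\<close>, which both the adjoint action and the smash product begin with.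
\<close>

definition \<theta> :: "('o, 'm) arrow" where
  "\<theta> = \<alpha>' b R b \<bullet> (Id b \<boxtimes> \<gamma> b R) \<bullet> \<alpha> b b R \<bullet> (Comult B \<boxtimes> Id R)"

lemma \<theta>_simps [simp]: "arr \<theta>" "src \<theta> = b \<odot> R" "trg \<theta> = (b \<odot> R) \<odot> b"
  by (simp_all add: \<theta>_def)

text \<open>
  In elements: \<open>(b r)\<^sub>1 \<otimes> \<pi>((b r)\<^sub>2) = b\<^sub>1 r\<^sub>1 \<otimes> (b\<^sub>2 \<lhd> r\<^sub>2) = b\<^sub>1 r \<otimes> b\<^sub>2\<close> if \<open>b \<lhd> r = b \<epsilon>(r)\<close>. The counit is
  moved in front of the exchange, whose fourth factor then is the unit object.
\<close>

lemma coaction_product: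
  assumes "ract_trivial"
  shows "(Id a \<boxtimes> q) \<bullet> Comult A \<bullet> Mult A \<bullet> (s \<boxtimes> j) = ((Mult A \<bullet> (s \<boxtimes> j)) \<boxtimes> Id b) \<bullet> \<theta>"
proof -
  have "(Id a \<boxtimes> q) \<bullet> Comult A \<bullet> Mult A \<bullet> (s \<boxtimes> j)
      = ((Mult A \<bullet> (s \<boxtimes> j)) \<boxtimes> (q \<bullet> Mult A \<bullet> (s \<boxtimes> j))) \<bullet> \<tau> b b R R \<bullet> (Comult B \<boxtimes> Comult coinv)"
    using Comult_product [OF A, where F = s and D = "Comult B" and G = j and E = "Comult coinv"]
    by (simp add: j_Comult s_hom) (simp add: merge)
  also have "\<dots> = ((Mult A \<bullet> (s \<boxtimes> j)) \<boxtimes> Id b) \<bullet> (Id (b \<odot> R) \<boxtimes> \<r> b)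
      \<bullet> ((Id b \<boxtimes> Id R) \<boxtimes> (Id b \<boxtimes> Counit coinv)) \<bullet> \<tau> b b R R \<bullet> (Comult B \<boxtimes> Comult coinv)"
    using assms unfolding ract_trivial_arrow by (simp add: merge)
  also have "\<dots> = ((Mult A \<bullet> (s \<boxtimes> j)) \<boxtimes> Id b) \<bullet> (Id (b \<odot> R) \<boxtimes> \<r> b)
      \<bullet> \<tau> b b R \<one> \<bullet> ((Id b \<boxtimes> Id b) \<boxtimes> (Id R \<boxtimes> Counit coinv)) \<bullet> (Comult B \<boxtimes> Comult coinv)"
    by (simp add: reassoc [OF \<tau>_natural] del: Id_tensor)
  also have "\<dots> = ((Mult A \<bullet> (s \<boxtimes> j)) \<boxtimes> Id b) \<bullet> (Id (b \<odot> R) \<boxtimes> \<r> b) \<bullet> \<tau> b b R \<one> \<bullet> (Comult B \<boxtimes> \<r>' R)"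
    by (simp add: merge Counit_coinv_right)
  also have "\<dots> = ((Mult A \<bullet> (s \<boxtimes> j)) \<boxtimes> Id b) \<bullet> \<theta>"
    by (simp add: reassoc [OF \<tau>_one_fourth]) (simp add: \<theta>_def merge)
  finally show ?thesis .
qed

lemma act_eq_adjoint:
  assumes "ract_trivial"
  shows "j \<bullet> act = Mult A \<bullet> (Mult A \<boxtimes> Id a) \<bullet> ((s \<boxtimes> j) \<boxtimes> (s \<bullet> T)) \<bullet> \<theta>"
proof -
  have "j \<bullet> act = (j \<bullet> P) \<bullet> Mult A \<bullet> (s \<boxtimes> j)"
    by (simp add: act_def)
  also have "\<dots> = Mult A \<bullet> (Id a \<boxtimes> (s \<bullet> T)) \<bullet> (Id a \<boxtimes> q) \<bullet> Comult A \<bullet> Mult A \<bullet> (s \<boxtimes> j)"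
    by (simp only: j_P_coaction) simp
  also have "\<dots> = Mult A \<bullet> (Mult A \<boxtimes> Id a) \<bullet> ((s \<boxtimes> j) \<boxtimes> (s \<bullet> T)) \<bullet> \<theta>"
    by (simp only: coaction_product [OF assms]) (simp add: merge)
  finally show ?thesis .
qed

text \<open>
  The commutation rule \<open>(b\<^sub>1 \<rhd> r) b\<^sub>2 = b r\<close>: the left side is \<open>\<phi> \<psi>(b r)\<close> by the coaction formula.
\<close>

lemma \<phi>_act_\<theta>:
  assumes "ract_trivial"
  shows "\<phi> \<bullet> (act \<boxtimes> Id b) \<bullet> \<theta> = Mult A \<bullet> (s \<boxtimes> j)"
proof -
  have "\<phi> \<bullet> (act \<boxtimes> Id b) \<bullet> \<theta> = \<phi> \<bullet> (P \<boxtimes> Id b) \<bullet> ((Mult A \<bullet> (s \<boxtimes> j)) \<boxtimes> Id b) \<bullet> \<theta>"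
    by (simp add: act_def merge)
  also have "\<dots> = \<phi> \<bullet> (P \<boxtimes> Id b) \<bullet> (Id a \<boxtimes> q) \<bullet> Comult A \<bullet> Mult A \<bullet> (s \<boxtimes> j)"
    by (simp only: coaction_product [OF assms])
  also have "\<dots> = (\<phi> \<bullet> \<psi>) \<bullet> Mult A \<bullet> (s \<boxtimes> j)"
    by (simp add: \<psi>_def merge)
  finally show ?thesis by (simp add: \<phi>_\<psi>)
qed

text \<open>
  Left linearity of \<open>\<pi>\<close> gives \<open>\<pi>(b r) = b \<pi>(r) = b \<epsilon>(r)\<close>. Conversely, as
  \<open>\<phi>\<close> is invertible, it suffices that \<open>\<pi>(b r b') = \<pi>(b r) b' = b \<epsilon>(r) b' = b \<pi>(r b')\<close>.
\<close>

lemma ract_trivial_iff_q_linear: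
  "ract_trivial \<longleftrightarrow> q \<bullet> Mult A \<bullet> (s \<boxtimes> Id a) = Mult B \<bullet> (Id b \<boxtimes> q)"
proof
  assume lin: "q \<bullet> Mult A \<bullet> (s \<boxtimes> Id a) = Mult B \<bullet> (Id b \<boxtimes> q)"
  have "q \<bullet> Mult A \<bullet> (s \<boxtimes> j) = (q \<bullet> Mult A \<bullet> (s \<boxtimes> Id a)) \<bullet> (Id b \<boxtimes> j)"
    by (simp add: merge)
  also have "\<dots> = Mult B \<bullet> (Id b \<boxtimes> Unit B) \<bullet> (Id b \<boxtimes> Counit coinv)"
    by (simp only: lin) (simp add: merge q_j)
  also have "\<dots> = \<r> b \<bullet> (Id b \<boxtimes> Counit coinv)"
    by (simp add: reassoc [OF Mult_Unit_right [OF B]])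
  finally show ract_trivial
    by (simp add: ract_trivial_arrow)
next
  assume triv: ract_trivial
  have q_\<phi>: "q \<bullet> \<phi> = \<l> b \<bullet> (Counit coinv \<boxtimes> Id b)"
  proof -
    have "q \<bullet> \<phi> = (q \<bullet> Mult A \<bullet> (Id a \<boxtimes> s)) \<bullet> (j \<boxtimes> Id b)"
      by (simp add: \<phi>_def merge)
    also have "\<dots> = Mult B \<bullet> (Unit B \<boxtimes> Id b) \<bullet> (Counit coinv \<boxtimes> Id b)"
      by (simp only: q_linear) (simp add: merge q_j)
    finally show ?thesis
      by (simp add: reassoc [OF Mult_Unit_left [OF B]])
  qed
  show "q \<bullet> Mult A \<bullet> (s \<boxtimes> Id a) = Mult B \<bullet> (Id b \<boxtimes> q)"
  proof (rule cancel_epi [where G = "Id b \<boxtimes> \<phi>" and K = "Id b \<boxtimes> \<psi>"])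
    have "(q \<bullet> Mult A \<bullet> (s \<boxtimes> Id a)) \<bullet> (Id b \<boxtimes> \<phi>)
        = (q \<bullet> Mult A \<bullet> (Id a \<boxtimes> s)) \<bullet> ((Mult A \<bullet> (s \<boxtimes> j)) \<boxtimes> Id b) \<bullet> \<alpha>' b R b"
      by (simp add: merge Mult_\<phi>_left)
    also have "\<dots> = Mult B \<bullet> ((q \<bullet> Mult A \<bullet> (s \<boxtimes> j)) \<boxtimes> Id b) \<bullet> \<alpha>' b R b"
      by (simp only: q_linear) (simp add: merge)
    also have "\<dots> = Mult B \<bullet> (\<r> b \<boxtimes> Id b) \<bullet> ((Id b \<boxtimes> Counit coinv) \<boxtimes> Id b) \<bullet> \<alpha>' b R b"
      using triv by (simp add: ract_trivial_arrow merge)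
    also have "\<dots> = Mult B \<bullet> (\<r> b \<boxtimes> Id b) \<bullet> \<alpha>' b \<one> b \<bullet> (Id b \<boxtimes> (Counit coinv \<boxtimes> Id b))"
      by (simp add: \<alpha>'_natural)
    also have "\<dots> = (Mult B \<bullet> (Id b \<boxtimes> q)) \<bullet> (Id b \<boxtimes> \<phi>)"
      by (simp add: reassoc [OF triangle_arrow']) (simp add: merge q_\<phi>)
    finally show "(q \<bullet> Mult A \<bullet> (s \<boxtimes> Id a)) \<bullet> (Id b \<boxtimes> \<phi>) = (Mult B \<bullet> (Id b \<boxtimes> q)) \<bullet> (Id b \<boxtimes> \<phi>)" .
  qed (simp_all add: merge \<phi>_\<psi>)
qed


section \<open>Trivial cocycle and the bosonization\<close>

abbreviation "\<xi>_trivial \<equiv> cocycle_trivial M coinv B (cocycle M A \<pi> i)"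

lemma \<xi>_trivial_arrow:
  "\<xi>_trivial \<longleftrightarrow> q \<bullet> Mult A \<bullet> (j \<boxtimes> j) = Unit B \<bullet> \<l> \<one> \<bullet> (Counit coinv \<boxtimes> Counit coinv)"
proof -
  have "\<xi>_trivial \<longleftrightarrow>
      (q \<bullet> Mult A) \<bullet> (j \<boxtimes> j) = (Unit B \<bullet> \<l> \<one>) \<bullet> (Counit coinv \<boxtimes> Counit coinv)"
    by (simp add: cocycle_trivial_def cocycle_def coinvariant_data_def bialg_arrow_defs
        wp_arrow_defs arrow_defs mult_one_def)
  then show ?thesis by simp
qed

text \<open>
  A trivial cocycle makes \<open>r\<^sub>1 r'\<^sub>1 \<otimes> \<pi>(r\<^sub>2 r'\<^sub>2) = r r' \<otimes> 1\<close>, so products of elements of \<open>R\<close> are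
  coinvariant and fixed by \<open>i p\<close>.
\<close>

lemma j_Mult:
  assumes \<xi>_trivial
  shows "j \<bullet> Mult coinv = Mult A \<bullet> (j \<boxtimes> j)"
proof -
  have "(Id a \<boxtimes> q) \<bullet> Comult A \<bullet> Mult A \<bullet> (j \<boxtimes> j)
      = ((Mult A \<bullet> (j \<boxtimes> j)) \<boxtimes> (q \<bullet> Mult A \<bullet> (j \<boxtimes> j))) \<bullet> \<tau> R R R R \<bullet> (Comult coinv \<boxtimes> Comult coinv)"
    using Comult_product [OF A, where F = j and D = "Comult coinv" and G = j and E = "Comult coinv"]
    by (simp add: j_Comult) (simp add: merge)
  also have "\<dots> = ((Mult A \<bullet> (j \<boxtimes> j)) \<boxtimes> Unit B) \<bullet> (Id (R \<odot> R) \<boxtimes> \<l> \<one>)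
      \<bullet> ((Id R \<boxtimes> Id R) \<boxtimes> (Counit coinv \<boxtimes> Counit coinv)) \<bullet> \<tau> R R R R \<bullet> (Comult coinv \<boxtimes> Comult coinv)"
    using assms unfolding \<xi>_trivial_arrow by (simp add: merge)
  also have "\<dots> = ((Mult A \<bullet> (j \<boxtimes> j)) \<boxtimes> Unit B) \<bullet> (Id (R \<odot> R) \<boxtimes> \<l> \<one>) \<bullet> \<tau> R \<one> R \<one>
      \<bullet> ((Id R \<boxtimes> Counit coinv) \<boxtimes> (Id R \<boxtimes> Counit coinv)) \<bullet> (Comult coinv \<boxtimes> Comult coinv)"
    by (simp add: reassoc [OF \<tau>_natural] del: Id_tensor)
  also have "\<dots> = ((Mult A \<bullet> (j \<boxtimes> j)) \<boxtimes> Unit B) \<bullet> \<alpha>' R R \<one> \<bullet> (Id R \<boxtimes> \<r>' R)"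
    by (simp add: reassoc [OF \<tau>_one_second]) (simp add: merge Counit_coinv_right)
  also have "\<alpha>' R R \<one> \<bullet> (Id R \<boxtimes> \<r>' R) = \<r>' (R \<odot> R)"
    by (rule cancel_mono [where G = "\<r> (R \<odot> R)" and K = "\<r>' (R \<odot> R)"])
      (simp_all add: reassoc [OF \<r>_tensor'] merge)
  finally have coaction: "(Id a \<boxtimes> q) \<bullet> Comult A \<bullet> Mult A \<bullet> (j \<boxtimes> j)
      = ((Mult A \<bullet> (j \<boxtimes> j)) \<boxtimes> Unit B) \<bullet> \<r>' (R \<odot> R)" .
  have "j \<bullet> Mult coinv = (j \<bullet> P) \<bullet> Mult A \<bullet> (j \<boxtimes> j)"
    by (simp add: coinv_arrows)
  also have "\<dots> = Mult A \<bullet> (Id a \<boxtimes> (s \<bullet> T)) \<bullet> (Id a \<boxtimes> q) \<bullet> Comult A \<bullet> Mult A \<bullet> (j \<boxtimes> j)"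
    by (simp only: j_P_coaction) simp
  also have "\<dots> = Mult A \<bullet> ((Mult A \<bullet> (j \<boxtimes> j)) \<boxtimes> Unit A) \<bullet> \<r>' (R \<odot> R)"
    by (simp only: coaction) (simp add: merge sT_Unit)
  also have "\<dots> = Mult A \<bullet> (j \<boxtimes> j)"
    by (simp add: reassoc [OF Mult_Unit_arrow [OF A]])
  finally show ?thesis .
qed

abbreviation "smash \<equiv> bosonization M coinv B (left_act M A \<sigma> i p)"

lemma act_arrow: "act = Arrow (b \<odot> R) (left_act M A \<sigma> i p) R"
proof -
  have "act = (P \<bullet> Mult A) \<bullet> (s \<boxtimes> j)"
    by (simp add: act_def)
  then show ?thesis
    by (simp add: left_act_def bialg_arrow_defs wp_arrow_defs arrow_defs)
qed

lemma obj_smash [simp]: "obj smash = R \<odot> b"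
  by (simp add: bosonization_def)

lemma smash_arrows:
  "Mult smash = (Mult coinv \<boxtimes> Mult B) \<bullet> \<kappa>' R R b b \<bullet> (Id R \<boxtimes> (((act \<boxtimes> Id b) \<bullet> \<theta>) \<boxtimes> Id b)) \<bullet> \<kappa> R b R b"
  "Unit smash = (Unit coinv \<boxtimes> Unit B) \<bullet> \<l>' \<one>"
  "Comult smash = \<tau> R R b b \<bullet> (Comult coinv \<boxtimes> Comult B)"
  "Counit smash = \<l> \<one> \<bullet> (Counit coinv \<boxtimes> Counit B)"
proof -
  have "Mult smash = (((((((Mult coinv \<boxtimes> Mult B) \<bullet> \<kappa>' R R b b) \<bullet> (Id R \<boxtimes> ((act \<boxtimes> Id b) \<boxtimes> Id b)))
      \<bullet> (Id R \<boxtimes> (\<alpha>' b R b \<boxtimes> Id b))) \<bullet> (Id R \<boxtimes> ((Id b \<boxtimes> \<gamma> b R) \<boxtimes> Id b)))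
      \<bullet> (Id R \<boxtimes> (\<alpha> b b R \<boxtimes> Id b))) \<bullet> (Id R \<boxtimes> ((Comult B \<boxtimes> Id R) \<boxtimes> Id b))) \<bullet> \<kappa> R b R b"
    unfolding bosonization_def act_arrow
    by (simp add: bialg_arrow_defs arrow_defs \<kappa>_def \<kappa>'_def to_mid_def from_mid_def
        coinvariant_data_def)
  then show "Mult smash = (Mult coinv \<boxtimes> Mult B) \<bullet> \<kappa>' R R b b
      \<bullet> (Id R \<boxtimes> (((act \<boxtimes> Id b) \<bullet> \<theta>) \<boxtimes> Id b)) \<bullet> \<kappa> R b R b"
    by (simp add: merge \<theta>_def)
  have "Comult smash = ((\<kappa>' R b R b \<bullet> (Id R \<boxtimes> (\<gamma> R b \<boxtimes> Id b))) \<bullet> \<kappa> R R b b) \<bullet> (Comult coinv \<boxtimes> Comult B)"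
    unfolding bosonization_def
    by (simp add: bialg_arrow_defs arrow_defs \<kappa>_def \<kappa>'_def to_mid_def from_mid_def
        coinvariant_data_def)
  then show "Comult smash = \<tau> R R b b \<bullet> (Comult coinv \<boxtimes> Comult B)"
    by (simp add: \<tau>_def)
  show "Unit smash = (Unit coinv \<boxtimes> Unit B) \<bullet> \<l>' \<one>" "Counit smash = \<l> \<one> \<bullet> (Counit coinv \<boxtimes> Counit B)"
    by (simp_all add: bosonization_def bialg_arrow_defs arrow_defs mult_one_def comult_one_def
        coinvariant_data_def)
qed

lemma arr_smash [simp]: "arr (Mult smash)" "arr (Unit smash)" "arr (Comult smash)" "arr (Counit smash)"
  by (simp_all add: smash_arrows)

text \<open>
  In elements: \<open>r ((b\<^sub>1 \<rhd> r') b\<^sub>2) b' = r (b r') b'\<close>. The associativity constraints of the smash product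
  match the bracketing \<open>w ((x y) z)\<close> of \<open>Mult_Mult_\<kappa>\<close>.
\<close>

lemma \<phi>_Mult:
  assumes \<xi>_trivial ract_trivial
  shows "\<phi> \<bullet> Mult smash = Mult A \<bullet> (\<phi> \<boxtimes> \<phi>)"
proof -
  let ?\<chi> = "(act \<boxtimes> Id b) \<bullet> \<theta>"
  have "\<phi> \<bullet> Mult smash = Mult A \<bullet> (Mult A \<boxtimes> Mult A) \<bullet> ((j \<boxtimes> j) \<boxtimes> (s \<boxtimes> s)) \<bullet> \<kappa>' R R b b
      \<bullet> (Id R \<boxtimes> (?\<chi> \<boxtimes> Id b)) \<bullet> \<kappa> R b R b"
    unfolding \<phi>_def smash_arrows by (simp add: merge s_hom j_Mult [OF assms(1)])
  also have "\<dots> = Mult A \<bullet> (Id a \<boxtimes> (Mult A \<bullet> (Mult A \<boxtimes> Id a))) \<bullet> \<kappa> a a a a \<bullet> ((j \<boxtimes> j) \<boxtimes> (s \<boxtimes> s))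
      \<bullet> \<kappa>' R R b b \<bullet> (Id R \<boxtimes> (?\<chi> \<boxtimes> Id b)) \<bullet> \<kappa> R b R b"
    by (simp add: reassoc [OF Mult_Mult_\<kappa> [OF A]])
  also have "\<dots> = Mult A \<bullet> (Id a \<boxtimes> (Mult A \<bullet> (Mult A \<boxtimes> Id a))) \<bullet> (j \<boxtimes> ((j \<boxtimes> s) \<boxtimes> s))
      \<bullet> (Id R \<boxtimes> (?\<chi> \<boxtimes> Id b)) \<bullet> \<kappa> R b R b"
    by (simp add: reassoc [OF \<kappa>_natural])
  also have "\<dots> = Mult A \<bullet> (j \<boxtimes> (Mult A \<bullet> ((\<phi> \<bullet> ?\<chi>) \<boxtimes> s))) \<bullet> \<kappa> R b R b"
    by (simp add: merge \<phi>_def)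
  also have "\<dots> = Mult A \<bullet> (Id a \<boxtimes> (Mult A \<bullet> (Mult A \<boxtimes> Id a))) \<bullet> (j \<boxtimes> ((s \<boxtimes> j) \<boxtimes> s)) \<bullet> \<kappa> R b R b"
    by (simp only: \<phi>_act_\<theta> [OF assms(2)]) (simp add: merge)
  also have "\<dots> = Mult A \<bullet> (Id a \<boxtimes> (Mult A \<bullet> (Mult A \<boxtimes> Id a))) \<bullet> \<kappa> a a a a \<bullet> ((j \<boxtimes> s) \<boxtimes> (j \<boxtimes> s))"
    by (simp add: \<kappa>_natural)
  also have "\<dots> = Mult A \<bullet> (Mult A \<boxtimes> Mult A) \<bullet> ((j \<boxtimes> s) \<boxtimes> (j \<boxtimes> s))"
    by (simp add: reassoc [OF Mult_Mult_\<kappa> [OF A]])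
  also have "\<dots> = Mult A \<bullet> (\<phi> \<boxtimes> \<phi>)"
    by (simp add: merge \<phi>_def)
  finally show ?thesis .
qed

lemma \<phi>_Unit: "\<phi> \<bullet> Unit smash = Unit A"
proof -
  have "\<phi> \<bullet> Unit smash = Mult A \<bullet> (Unit A \<boxtimes> Id a) \<bullet> (Id \<one> \<boxtimes> Unit A) \<bullet> \<l>' \<one>"
    unfolding \<phi>_def smash_arrows by (simp add: merge s_hom j_Unit)
  also have "\<dots> = Unit A"
    by (simp add: reassoc [OF Mult_Unit_left [OF A]] reassoc [OF \<l>_natural])
  finally show ?thesis .
qed

lemma \<phi>_Counit: "Counit A \<bullet> \<phi> = Counit smash"
  unfolding \<phi>_def smash_arrows
  by (simp add: reassoc [OF Counit_Mult [OF A]] merge s_hom) (simp add: coinv_arrows(4))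

lemma bosonization_isomorphic:
  assumes \<xi>_trivial ract_trivial
  shows "bialgebras_isomorphic M A smash"
proof -
  have FG: "arr \<psi>" "\<phi> \<bullet> \<psi> = Id a" "\<psi> \<bullet> \<phi> = Id (obj smash)" "\<phi> \<bullet> Mult smash = Mult A \<bullet> (\<phi> \<boxtimes> \<phi>)"
    "\<phi> \<bullet> Unit smash = Unit A" "Comult A \<bullet> \<phi> = (\<phi> \<boxtimes> \<phi>) \<bullet> Comult smash" "Counit A \<bullet> \<phi> = Counit smash"
    using assms by (simp_all add: \<phi>_Mult \<phi>_Unit \<phi>_Comult \<phi>_Counit \<phi>_\<psi> \<psi>_\<phi> smash_arrows(3))
  have "is_bialgebra M smash"
    by (rule bialgebra_transport [OF A, where F = \<phi> and G = \<psi>]) (simp_all add: FG)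
  have mult: "\<psi> \<bullet> Mult A = Mult smash \<bullet> (\<psi> \<boxtimes> \<psi>)"
    by (rule cancel_mono [where G = \<phi> and K = \<psi>])
      (simp_all add: FG reassoc [OF FG(2)] reassoc [OF FG(4)] interchange)
  have unit: "\<psi> \<bullet> Unit A = Unit smash"
    using reassoc [OF FG(3), of "Unit smash"] by (simp add: FG(5))
  have comult: "Comult smash \<bullet> \<psi> = (\<psi> \<boxtimes> \<psi>) \<bullet> Comult A"
  proof (rule cancel_mono [where G = "\<phi> \<boxtimes> \<phi>" and K = "\<psi> \<boxtimes> \<psi>"])
    show "(\<phi> \<boxtimes> \<phi>) \<bullet> Comult smash \<bullet> \<psi> = (\<phi> \<boxtimes> \<phi>) \<bullet> (\<psi> \<boxtimes> \<psi>) \<bullet> Comult A"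
      by (simp add: reassoc [OF FG(6) [symmetric]] merge FG(2))
  qed (simp_all add: interchange FG)
  have counit: "Counit smash \<bullet> \<psi> = Counit A"
    by (simp add: FG(2) flip: FG(7))
  have types: "mor \<phi> \<in> Hom (obj smash) a" "mor \<psi> \<in> Hom a (obj smash)"
    using \<phi>_\<psi>_simps by (simp_all add: arr_def)
  have "is_iso M a (obj smash) (mor \<psi>)"
    unfolding is_iso_def inverse_pair_def
    using types FG(2,3) [THEN arg_cong [where f = mor]]
    by (auto simp: comp_arrow_def Id_def)
  moreover have "is_bialgebra_hom M A smash (mor \<psi>)"
    unfolding is_bialgebra_hom_def is_algebra_hom_def is_coalgebra_hom_def
    using types mult [THEN arg_cong [where f = mor]] unit [THEN arg_cong [where f = mor]]
      comult [THEN arg_cong [where f = mor]] counit [THEN arg_cong [where f = mor]]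
    by (simp add: comp_arrow_def tensor_arrow_def bialg_arrow_defs)
  ultimately show ?thesis
    using A \<open>is_bialgebra M smash\<close> unfolding bialgebras_isomorphic_def by blast
qed

section \<open>The conclusions for untyped morphisms\<close>

lemma ract_trivial_iff_left_linear: "ract_trivial \<longleftrightarrow> is_left_linear M A B \<sigma> \<pi>"
proof -
  have "is_left_linear M A B \<sigma> \<pi>
      \<longleftrightarrow> (q \<bullet> Mult A) \<bullet> (s \<boxtimes> Id a) = Mult B \<bullet> (Id b \<boxtimes> q)"
    by (simp add: is_left_linear_def bialg_arrow_defs wp_arrow_defs arrow_defs)
  then show ?thesis by (simp add: ract_trivial_iff_q_linear)
qed

lemma left_act_is_adjoint:
  assumes ract_trivial
  shows "i \<cdot> left_act M A \<sigma> i p = adjoint_act M A B \<sigma> S R i"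
proof -
  have "((((((Mult A \<bullet> (Mult A \<boxtimes> Id a)) \<bullet> ((s \<boxtimes> j) \<boxtimes> (s \<bullet> T))) \<bullet> \<alpha>' b R b)
      \<bullet> (Id b \<boxtimes> \<gamma> b R)) \<bullet> \<alpha> b b R) \<bullet> (Comult B \<boxtimes> Id R)) = j \<bullet> act"
    by (simp add: act_eq_adjoint [OF assms] \<theta>_def)
  then show ?thesis
    unfolding act_arrow
    by (simp add: adjoint_act_def bialg_arrow_defs wp_arrow_defs arrow_defs)
qed

lemma left_act_is_action: "is_left_action M B R (left_act M A \<sigma> i p)"
proof -
  have "act \<bullet> (Mult B \<boxtimes> Id R) = (act \<bullet> (Id b \<boxtimes> act)) \<bullet> \<alpha> b b R"
    by (simp add: act_Mult)
  then show ?thesis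
    using act_simps(1) act_Unit unfolding act_arrow
    by (simp add: is_left_action_def bialg_arrow_defs arrow_defs)
qed

end

theorem proposition2p18:
  fixes M :: "('o, 'm) catdata" (structure)
    and A B :: "('o, 'm) bialg"
    and R :: 'o
    and S \<sigma> \<pi> i p :: 'm
  assumes category: "abelian_coabelian_braided_monoidal_category M"
    and bialgebra: "is_bialgebra M A"
    and sub_bialgebra: "is_sub_bialgebra M A B \<sigma>"
    and antipode: "is_antipode M B S"
    and projection: "is_right_weak_projection M A B \<sigma> \<pi>"
    and coinvariants: "is_coinvariants M A B \<pi> R i"
    and p: "p \<in> Hom (obj A) R" "i \<cdot> p = Pi2 M A \<sigma> S \<pi>" "p \<cdot> i = \<langle>R\<rangle>"
    and cocommutative: "is_cocommutative M A"
    and xi_trivial: "cocycle_trivial M (coinvariant_data M A R i p) B (cocycle M A \<pi> i)"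
  shows
    "(right_act_trivial M (coinvariant_data M A R i p) B (right_act M A \<sigma> \<pi> i)
        \<longleftrightarrow> is_left_linear M A B \<sigma> \<pi>) \<and>
     (right_act_trivial M (coinvariant_data M A R i p) B (right_act M A \<sigma> \<pi> i)
        \<longrightarrow> i \<cdot> left_act M A \<sigma> i p = adjoint_act M A B \<sigma> S R i) \<and>
     (right_act_trivial M (coinvariant_data M A R i p) B (right_act M A \<sigma> \<pi> i)
        \<longrightarrow> is_left_action M B R (left_act M A \<sigma> i p) \<and>
            i \<cdot> left_act M A \<sigma> i p = adjoint_act M A B \<sigma> S R i \<and>
            bialgebras_isomorphic M A
              (bosonization M (coinvariant_data M A R i p) B (left_act M A \<sigma> i p)))"
proof -
  interpret braided_monoidal_category M
    using category by (rule abelian_coabelian_braided_monoidal_category.axioms(2))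
  interpret cocommutative_weak_projection M A B R S \<sigma> \<pi> i p
    by (intro cocommutative_weak_projection.intro cocommutative_weak_projection_axioms.intro
        weak_projection.intro weak_projection_axioms.intro braided_monoidal_category_axioms)
      (fact bialgebra sub_bialgebra antipode projection coinvariants p cocommutative)+
  show ?thesis
    using ract_trivial_iff_left_linear left_act_is_adjoint left_act_is_action
      bosonization_isomorphic [OF xi_trivial] by blast
qed

end
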